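(* Let the dynamics, the cost $J$ and the control space $\mathcal{U}$ be as in the context. Let $\rho:L^1_{\mathcal{F}_T}(\Omega,\mathbb{R})\to\mathbb{R}$ be a finite coherent risk measure and let $u^*\in\mathcal{U}$ be an optimal solution of $\min_{u\in\mathcal{U}}\rho(J(u))$. Then there exists $\zeta^*\in\partial\rho(0)$ such that $$\langle \mathbb{E}[\zeta^*\nabla J(u^* )],h\rangle_{\mathcal{U}}=0\qquad\text{for every }h\in\mathcal{U}.$$
   Context: Fix $n,m,q\in\mathbb{N}$, $T>0$, a probability space $(\Omega,\mathcal{G},\mathbb{P})$, and a one-dimensional Wiener process $(W_t)_{t\in[0,T]}$ with filtration $\mathcal{F}_t=\sigma(W_s,0\le s\le t)$. $C^2_{\mathcal{F}}$ is the space of $\mathcal{F}$-adapted processes $x$ with continuous paths and $\|x\|_{C^2_{\mathcal F}}=\mathbb{E}[\sup_{0\le t\le T}\|x(t)\|^2]^{1/2}<\infty$. Dynamics (general non-linear setting): $dX_u(t)=b(t,X_u(t),u(t))\,dt+\sigma(t,X_u(t))\,dW_t$, $X_u(0)=X_0\in\mathbb{R}^n$ deterministic, where $b:[0,T]\times\mathbb{R}^n\times\mathbb{R}^m\to\mathbb{R}^n$ and $\sigma:[0,T]\times\mathbb{R}^n\to\mathbb{R}^n$ are continuous in $t$ and, for all $t$, differentiable in $(x,u)$, resp. $x$, with gradients that are bounded by a constant $L>0$ and $L$-Lipschitz (in $(x,u)$, resp. $x$), $L$ independent of $t$. Controls: $\mathcal{U}=L^2([0,T],\mathbb{R}^m)\times\mathbb{R}^q$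 with scalar product $\langle(v_1,\lambda_1),(v_2,\lambda_2)\rangle_{\mathcal{U}}=\int_0^T v_1(t)\cdot v_2(t)\,dt+\lambda_1\cdot\lambda_2$. Each $u=(v,\lambda)\in\mathcal{U}$ is identified with the feedback control $u(t)=v(t)+K_\lambda(X_u(t))$, where $K_\lambda:\mathbb{R}^n\to\mathbb{R}^m$ is smoothly parametrized by $\lambda\in\mathbb{R}^q$ and, for constants $C,L>0$ and all $x,y,\lambda,\mu$: $\|K_\lambda(x)-K_\lambda(y)\|\le C(1+\|\lambda\|)\|x-y\|$, $\|K_\lambda(x)-K_\mu(x)\|\le C(1+\|x\|)\|\lambda-\mu\|$, $\|\nabla_{\lambda,x}K_\lambda(x)-\nabla_{\lambda,x}K_\mu(y)\|\le L(\|x-y\|+\|\lambda-\mu\|)$. $X_u\in C^2_{\mathcal F}$ is the unique solution of the closed-loop equation. Cost: $J(u)=\int_0^T f(t,X_u(t),u(t))\,dt+g(T,X_u(T))$, where $f,g$ are positive continuous functions such that $f(t,\cdot,\cdot)$ and $g(t,\cdot)$ are $C^1$ with Lipschitz gradient in the state and control variables for all $t\in[0,T]$. The map $J:\mathcal{U}\to L^2_{\mathcal{F}_T}(\Omega,\mathbb{R})$ is Fréchet differentiable, and $\nabla J(u)\in L^2_{\mathcal{F}_T}(\Omega,\mathcal{U})$ denotes its Riesz gradient: $(D_uJ(u)\cdot h)(\omega)=\langle\nabla J(u)(\omega),h\rangle_{\mathcal{U}}$ for all $h\in\mathcal{U}$. $\mathbb{E}[\zeta\nabla J(u)]$ is the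 $\mathcal{U}$-valued expectation. Risk measure: a finite coherent risk measure is a map $\rho:L^p(\Omega,\mathbb{R})\to\mathbb{R}$ ($1\le p<\infty$; here $p=1$) that is convex, monotone ($Z\le Z'$ a.s. implies $\rho(Z)\le\rho(Z')$), translation equivariant ($\rho(Z+a)=\rho(Z)+a$, $a\in\mathbb{R}$) and positively homogeneous ($\rho(tZ)=t\rho(Z)$, $t\ge0$). $\partial\rho(0)$ is its convex subdifferential at $0$, a subset of $L^\infty_{\mathcal{F}_T}(\Omega,\mathbb{R})$. *)

theory Defs
  imports "HOL-Probability.Probability"
begin

abbreviation time_measure :: "real \<Rightarrow> real measure" where
  "time_measure t \<equiv> restrict_space lborel {0..t}"

definition wiener_filtration :: "'w measure \<Rightarrow> (real \<Rightarrow> 'w \<Rightarrow> real) \<Rightarrow> real \<Rightarrow> 'w measure" where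
  "wiener_filtration M W t =
     sigma (space M) (\<Union>s\<in>{0..t}. {W s -` A \<inter> space M | A. A \<in> sets borel})"

definition wiener_process :: "'w measure \<Rightarrow> real \<Rightarrow> (real \<Rightarrow> 'w \<Rightarrow> real) \<Rightarrow> bool" where
  "wiener_process M T W \<longleftrightarrow>
     (\<forall>t\<in>{0..T}. W t \<in> borel_measurable M) \<and>
     (AE \<omega> in M. W 0 \<omega> = 0) \<and>
     (AE \<omega> in M. continuous_on {0..T} (\<lambda>t. W t \<omega>)) \<and>
     (\<forall>s t. 0 \<le> s \<and> s < t \<and> t \<le> T \<longrightarrow>
        distributed M lborel (\<lambda>\<omega>. W t \<omega> - W s \<omega>) (normal_density 0 (sqrt (t - s))) \<and>
        prob_space.indep_set M (sets (wiener_filtration M W s))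
          {(\<lambda>\<omega>. W t \<omega> - W s \<omega>) -` A \<inter> space M | A. A \<in> sets borel})"

text \<open>The filtration is not completed, so path continuity is required almost surely. The supremum
  below then agrees almost everywhere with a measurable function, which is all that \<open>nn_integral\<close>
  needs.\<close>

definition C2_process ::
  "'w measure \<Rightarrow> (real \<Rightarrow> 'w measure) \<Rightarrow> real \<Rightarrow> (real \<Rightarrow> 'w \<Rightarrow> real^'n) \<Rightarrow> bool" where
  "C2_process M F T x \<longleftrightarrow>
     (\<forall>t\<in>{0..T}. x t \<in> borel_measurable (F t)) \<and>
     (AE \<omega> in M. continuous_on {0..T} (\<lambda>t. x t \<omega>)) \<and>
     (\<integral>\<^sup>+\<omega>. (\<Squnion>t\<in>{0..T}. ennreal ((norm (x t \<omega>))\<^sup>2)) \<partial>M) < \<infinity>"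

text \<open>A simple process is given by a partition \<open>0 = p 0 < \<dots> < p N = T\<close> and bounded random
  vectors \<open>\<xi> i\<close> that are measurable at time \<open>p i\<close>.\<close>

definition simple_data ::
  "'w measure \<Rightarrow> (real \<Rightarrow> 'w measure) \<Rightarrow> real \<Rightarrow> nat \<Rightarrow> (nat \<Rightarrow> real) \<Rightarrow> (nat \<Rightarrow> 'w \<Rightarrow> real^'n) \<Rightarrow> bool" where
  "simple_data M F T N p \<xi> \<longleftrightarrow>
     p 0 = 0 \<and> p N = T \<and> strict_mono_on {..N} p \<and>
     (\<forall>i<N. \<xi> i \<in> borel_measurable (F (p i)) \<and> (\<exists>C. \<forall>\<omega>\<in>space M. norm (\<xi> i \<omega>) \<le> C))"

definition simple_process ::
  "nat \<Rightarrow> (nat \<Rightarrow> real) \<Rightarrow> (nat \<Rightarrow> 'w \<Rightarrow> real^'n) \<Rightarrow> real \<Rightarrow> 'w \<Rightarrow> real^'n" where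
  "simple_process N p \<xi> t \<omega> = (\<Sum>i<N. indicator {p i<..p (Suc i)} t *\<^sub>R \<xi> i \<omega>)"

definition simple_integral ::
  "(real \<Rightarrow> 'w \<Rightarrow> real) \<Rightarrow> nat \<Rightarrow> (nat \<Rightarrow> real) \<Rightarrow> (nat \<Rightarrow> 'w \<Rightarrow> real^'n) \<Rightarrow> real \<Rightarrow> 'w \<Rightarrow> real^'n" where
  "simple_integral W N p \<xi> t \<omega> =
     (\<Sum>i<N. (W (min (p (Suc i)) t) \<omega> - W (min (p i) t) \<omega>) *\<^sub>R \<xi> i \<omega>)"

text \<open>\<open>ito_integral M W T H I\<close>: the process \<open>I\<close> is a continuous version of
  \<open>t \<mapsto> \<integral>\<^sub>0\<^sup>t H dW\<close> for a square integrable integrand \<open>H\<close>, that is, an \<open>L\<^sup>2\<close>-limit of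
  integrals of simple processes converging to \<open>H\<close> in \<open>L\<^sup>2(\<Omega> \<times> [0,T])\<close>.\<close>

definition ito_integral ::
  "'w measure \<Rightarrow> (real \<Rightarrow> 'w \<Rightarrow> real) \<Rightarrow> real \<Rightarrow> (real \<Rightarrow> 'w \<Rightarrow> real^'n) \<Rightarrow> (real \<Rightarrow> 'w \<Rightarrow> real^'n) \<Rightarrow> bool" where
  "ito_integral M W T H I \<longleftrightarrow>
     (\<forall>t\<in>{0..T}. I t \<in> borel_measurable (wiener_filtration M W t)) \<and>
     (AE \<omega> in M. continuous_on {0..T} (\<lambda>t. I t \<omega>)) \<and>
     (\<exists>N p \<xi>.
        (\<forall>k::nat. simple_data M (wiener_filtration M W) T (N k) (p k) (\<xi> k)) \<and>
        (\<lambda>k. \<integral>\<^sup>+\<omega>. (\<integral>\<^sup>+t. ennreal ((norm (simple_process (N k) (p k) (\<xi> k) t \<omega> - H t \<omega>))\<^sup>2)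
               \<partial>time_measure T) \<partial>M) \<longlonglongrightarrow> 0 \<and>
        (\<forall>t\<in>{0..T}.
          (\<lambda>k. \<integral>\<^sup>+\<omega>. ennreal ((norm (simple_integral W (N k) (p k) (\<xi> k) t \<omega> - I t \<omega>))\<^sup>2) \<partial>M)
            \<longlonglongrightarrow> 0))"

text \<open>Elements of \<open>L\<^sup>2([0,T],\<real>\<^sup>m) \<times> \<real>\<^sup>q\<close> are handled through representatives; the values of the
  first component outside \<open>[0,T]\<close> are irrelevant.\<close>

type_synonym ('m, 'q) control = "(real \<Rightarrow> real^'m) \<times> (real^'q)"

definition control_space :: "real \<Rightarrow> ('m::finite, 'q::finite) control set" where
  "control_space T = {u. fst u \<in> borel_measurable (time_measure T) \<and>
                         integrable (time_measure T) (\<lambda>t. (norm (fst u t))\<^sup>2)}"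

definition control_add ::
  "('m::finite, 'q::finite) control \<Rightarrow> ('m, 'q) control \<Rightarrow> ('m, 'q) control" where
  "control_add u h = (\<lambda>t. fst u t + fst h t, snd u + snd h)"

definition control_scale :: "real \<Rightarrow> ('m::finite, 'q::finite) control \<Rightarrow> ('m, 'q) control" where
  "control_scale c h = (\<lambda>t. c *\<^sub>R fst h t, c *\<^sub>R snd h)"

definition control_inner ::
  "real \<Rightarrow> ('m::finite, 'q::finite) control \<Rightarrow> ('m, 'q) control \<Rightarrow> real" where
  "control_inner T u h = (\<integral>t. fst u t \<bullet> fst h t \<partial>time_measure T) + snd u \<bullet> snd h"

definition control_norm :: "real \<Rightarrow> ('m::finite, 'q::finite) control \<Rightarrow> real" where
  "control_norm T h = sqrt (control_inner T h h)"

definition feedback ::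
  "(real^'q \<Rightarrow> real^'n \<Rightarrow> real^'m) \<Rightarrow> ('m::finite, 'q::finite) control \<Rightarrow>
   (real \<Rightarrow> 'w \<Rightarrow> real^'n) \<Rightarrow> real \<Rightarrow> 'w \<Rightarrow> real^'m" where
  "feedback K u x t \<omega> = fst u t + K (snd u) (x t \<omega>)"

definition lipschitz_gradient ::
  "real \<Rightarrow> ('a::real_normed_vector \<Rightarrow> 'b::real_normed_vector) \<Rightarrow> ('a \<Rightarrow> 'a \<Rightarrow>\<^sub>L 'b) \<Rightarrow> bool" where
  "lipschitz_gradient L \<phi> D \<longleftrightarrow>
     (\<forall>z. (\<phi> has_derivative blinfun_apply (D z)) (at z)) \<and> L-lipschitz_on UNIV D"

definition admissible_drift :: "real \<Rightarrow> (real \<Rightarrow> real^'n \<Rightarrow> real^'m \<Rightarrow> real^'n) \<Rightarrow> real \<Rightarrow> bool" where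
  "admissible_drift T b L \<longleftrightarrow>
     (\<forall>x a. continuous_on {0..T} (\<lambda>t. b t x a)) \<and>
     (\<forall>t\<in>{0..T}. \<exists>D. lipschitz_gradient L (\<lambda>(x, a). b t x a) D \<and> (\<forall>z. norm (D z) \<le> L))"

definition admissible_diffusion :: "real \<Rightarrow> (real \<Rightarrow> real^'n \<Rightarrow> real^'n) \<Rightarrow> real \<Rightarrow> bool" where
  "admissible_diffusion T \<sigma> L \<longleftrightarrow>
     (\<forall>x. continuous_on {0..T} (\<lambda>t. \<sigma> t x)) \<and>
     (\<forall>t\<in>{0..T}. \<exists>D. lipschitz_gradient L (\<sigma> t) D \<and> (\<forall>z. norm (D z) \<le> L))"

definition admissible_feedback :: "(real^'q \<Rightarrow> real^'n \<Rightarrow> real^'m) \<Rightarrow> bool" where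
  "admissible_feedback K \<longleftrightarrow>
     (\<exists>C>0. \<exists>L>0.
        (\<forall>l x y. norm (K l x - K l y) \<le> C * (1 + norm l) * norm (x - y)) \<and>
        (\<forall>l m x. norm (K l x - K m x) \<le> C * (1 + norm x) * norm (l - m)) \<and>
        (\<exists>D :: (real^'q) \<times> (real^'n) \<Rightarrow> ((real^'q) \<times> (real^'n)) \<Rightarrow>\<^sub>L (real^'m).
           (\<forall>z. ((\<lambda>(l, x). K l x) has_derivative blinfun_apply (D z)) (at z)) \<and>
           (\<forall>l m x y. norm (D (l, x) - D (m, y)) \<le> L * (norm (x - y) + norm (l - m)))))"

definition admissible_cost ::
  "real \<Rightarrow> (real \<Rightarrow> real^'n \<Rightarrow> real^'m \<Rightarrow> real) \<Rightarrow> (real \<Rightarrow> real^'n \<Rightarrow> real) \<Rightarrow> bool" where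
  "admissible_cost T f g \<longleftrightarrow>
     continuous_on ({0..T} \<times> UNIV) (\<lambda>(t, x, a). f t x a) \<and>
     continuous_on ({0..T} \<times> UNIV) (\<lambda>(t, x). g t x) \<and>
     (\<forall>t\<in>{0..T}. (\<forall>x a. 0 \<le> f t x a) \<and> (\<forall>x. 0 \<le> g t x) \<and>
        (\<exists>L D. lipschitz_gradient L (\<lambda>(x, a). f t x a) D) \<and>
        (\<exists>L D. lipschitz_gradient L (g t) D))"

definition closed_loop_solution ::
  "'w measure \<Rightarrow> (real \<Rightarrow> 'w \<Rightarrow> real) \<Rightarrow> real \<Rightarrow>
   (real \<Rightarrow> real^'n \<Rightarrow> real^'m \<Rightarrow> real^'n) \<Rightarrow> (real \<Rightarrow> real^'n \<Rightarrow> real^'n) \<Rightarrow> real^'n \<Rightarrow>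
   (real^'q \<Rightarrow> real^'n \<Rightarrow> real^'m) \<Rightarrow> ('m::finite, 'q::finite) control \<Rightarrow>
   (real \<Rightarrow> 'w \<Rightarrow> real^'n) \<Rightarrow> bool" where
  "closed_loop_solution M W T b \<sigma> X0 K u X \<longleftrightarrow>
     C2_process M (wiener_filtration M W) T X \<and>
     (\<exists>I. ito_integral M W T (\<lambda>t \<omega>. \<sigma> t (X t \<omega>)) I \<and>
        (AE \<omega> in M. \<forall>t\<in>{0..T}.
           X t \<omega> = X0 + (\<integral>s. b s (X s \<omega>) (feedback K u X s \<omega>) \<partial>time_measure t) + I t \<omega>))"

definition unique_closed_loop_solution ::
  "'w measure \<Rightarrow> (real \<Rightarrow> 'w \<Rightarrow> real) \<Rightarrow> real \<Rightarrow>
   (real \<Rightarrow> real^'n \<Rightarrow> real^'m \<Rightarrow> real^'n) \<Rightarrow> (real \<Rightarrow> real^'n \<Rightarrow> real^'n) \<Rightarrow> real^'n \<Rightarrow>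
   (real^'q \<Rightarrow> real^'n \<Rightarrow> real^'m) \<Rightarrow> ('m::finite, 'q::finite) control \<Rightarrow>
   (real \<Rightarrow> 'w \<Rightarrow> real^'n) \<Rightarrow> bool" where
  "unique_closed_loop_solution M W T b \<sigma> X0 K u X \<longleftrightarrow>
     closed_loop_solution M W T b \<sigma> X0 K u X \<and>
     (\<forall>Y. closed_loop_solution M W T b \<sigma> X0 K u Y \<longrightarrow>
        (AE \<omega> in M. \<forall>t\<in>{0..T}. Y t \<omega> = X t \<omega>))"

definition Lp :: "nat \<Rightarrow> 'w measure \<Rightarrow> 'w measure \<Rightarrow> ('w \<Rightarrow> real) set" where
  "Lp p M F = {Z. Z \<in> borel_measurable F \<and> integrable M (\<lambda>\<omega>. \<bar>Z \<omega>\<bar> ^ p)}"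

definition Linf :: "'w measure \<Rightarrow> 'w measure \<Rightarrow> ('w \<Rightarrow> real) set" where
  "Linf M F = {Z. Z \<in> borel_measurable F \<and> (\<exists>C. AE \<omega> in M. \<bar>Z \<omega>\<bar> \<le> C)}"

definition L2_norm :: "'w measure \<Rightarrow> ('w \<Rightarrow> real) \<Rightarrow> real" where
  "L2_norm M Z = sqrt (\<integral>\<omega>. (Z \<omega>)\<^sup>2 \<partial>M)"

text \<open>The space \<open>L\<^sup>2(\<Omega>, \<U>)\<close>: since \<open>\<U>\<close> is separable, every element of the Bochner space has a
  representative whose first component is jointly measurable in \<open>(\<omega>, t)\<close>.\<close>

definition L2_control :: "'w measure \<Rightarrow> 'w measure \<Rightarrow> real \<Rightarrow> ('w \<Rightarrow> ('m::finite, 'q::finite) control) set" where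
  "L2_control M F T = {G.
     (\<lambda>(\<omega>, t). fst (G \<omega>) t) \<in> borel_measurable (F \<Otimes>\<^sub>M time_measure T) \<and>
     (\<lambda>\<omega>. snd (G \<omega>)) \<in> borel_measurable F \<and>
     (\<integral>\<^sup>+\<omega>. ((\<integral>\<^sup>+t. ennreal ((norm (fst (G \<omega>) t))\<^sup>2) \<partial>time_measure T)
             + ennreal ((norm (snd (G \<omega>)))\<^sup>2)) \<partial>M) < \<infinity>}"

text \<open>For jointly measurable representatives the Bochner expectation is obtained by integrating the
  first component for each (almost every) \<open>t\<close> separately.\<close>

definition control_expectation ::
  "'w measure \<Rightarrow> ('w \<Rightarrow> ('m::finite, 'q::finite) control) \<Rightarrow> ('m, 'q) control" where
  "control_expectation M G = (\<lambda>t. \<integral>\<omega>. fst (G \<omega>) t \<partial>M, \<integral>\<omega>. snd (G \<omega>) \<partial>M)"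

text \<open>\<open>J u\<close> is an \<open>F\<^sub>T\<close>-measurable representative of the class of the random cost in \<open>L\<^sup>2\<close>.\<close>

definition cost_functional ::
  "'w measure \<Rightarrow> 'w measure \<Rightarrow> real \<Rightarrow>
   (real \<Rightarrow> real^'n \<Rightarrow> real^'m \<Rightarrow> real) \<Rightarrow> (real \<Rightarrow> real^'n \<Rightarrow> real) \<Rightarrow>
   (real^'q \<Rightarrow> real^'n \<Rightarrow> real^'m) \<Rightarrow>
   (('m::finite, 'q::finite) control \<Rightarrow> real \<Rightarrow> 'w \<Rightarrow> real^'n) \<Rightarrow>
   (('m, 'q) control \<Rightarrow> 'w \<Rightarrow> real) \<Rightarrow> bool" where
  "cost_functional M F T f g K X J \<longleftrightarrow>
     (\<forall>u\<in>control_space T. J u \<in> Lp 2 M F \<and>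
        (AE \<omega> in M.
           integrable (time_measure T) (\<lambda>t. f t (X u t \<omega>) (feedback K u (X u) t \<omega>)) \<and>
           J u \<omega> = (\<integral>t. f t (X u t \<omega>) (feedback K u (X u) t \<omega>) \<partial>time_measure T) + g T (X u T \<omega>)))"

definition has_frechet_derivative_L2 ::
  "'w measure \<Rightarrow> 'w measure \<Rightarrow> real \<Rightarrow> (('m::finite, 'q::finite) control \<Rightarrow> 'w \<Rightarrow> real) \<Rightarrow>
   ('m, 'q) control \<Rightarrow> (('m, 'q) control \<Rightarrow> 'w \<Rightarrow> real) \<Rightarrow> bool" where
  "has_frechet_derivative_L2 M F T J u D \<longleftrightarrow>
     (\<forall>h\<in>control_space T. D h \<in> Lp 2 M F) \<and>
     (\<forall>h\<in>control_space T. \<forall>k\<in>control_space T.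
        AE \<omega> in M. D (control_add h k) \<omega> = D h \<omega> + D k \<omega>) \<and>
     (\<forall>c. \<forall>h\<in>control_space T. AE \<omega> in M. D (control_scale c h) \<omega> = c * D h \<omega>) \<and>
     (\<exists>C. \<forall>h\<in>control_space T. L2_norm M (D h) \<le> C * control_norm T h) \<and>
     (\<forall>\<epsilon>>0. \<exists>\<delta>>0. \<forall>h\<in>control_space T. control_norm T h < \<delta> \<longrightarrow>
        L2_norm M (\<lambda>\<omega>. J (control_add u h) \<omega> - J u \<omega> - D h \<omega>) \<le> \<epsilon> * control_norm T h)"

definition riesz_gradient ::
  "'w measure \<Rightarrow> 'w measure \<Rightarrow> real \<Rightarrow> (('m::finite, 'q::finite) control \<Rightarrow> 'w \<Rightarrow> real) \<Rightarrow>
   ('m, 'q) control \<Rightarrow> ('w \<Rightarrow> ('m, 'q) control) \<Rightarrow> bool" where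
  "riesz_gradient M F T J u G \<longleftrightarrow>
     G \<in> L2_control M F T \<and>
     (\<exists>D. has_frechet_derivative_L2 M F T J u D \<and>
          (\<forall>h\<in>control_space T. AE \<omega> in M. D h \<omega> = control_inner T (G \<omega>) h))"

text \<open>Monotonicity makes \<open>\<rho>\<close> invariant under almost sure equality, so it acts on classes.\<close>

definition coherent_risk_measure :: "'w measure \<Rightarrow> 'w measure \<Rightarrow> (('w \<Rightarrow> real) \<Rightarrow> real) \<Rightarrow> bool" where
  "coherent_risk_measure M F \<rho> \<longleftrightarrow>
     (\<forall>Z\<in>Lp 1 M F. \<forall>Z'\<in>Lp 1 M F. \<forall>\<alpha>\<in>{0..1}.
        \<rho> (\<lambda>\<omega>. \<alpha> * Z \<omega> + (1 - \<alpha>) * Z' \<omega>) \<le> \<alpha> * \<rho> Z + (1 - \<alpha>) * \<rho> Z') \<and>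
     (\<forall>Z\<in>Lp 1 M F. \<forall>Z'\<in>Lp 1 M F. (AE \<omega> in M. Z \<omega> \<le> Z' \<omega>) \<longrightarrow> \<rho> Z \<le> \<rho> Z') \<and>
     (\<forall>Z\<in>Lp 1 M F. \<forall>a. \<rho> (\<lambda>\<omega>. Z \<omega> + a) = \<rho> Z + a) \<and>
     (\<forall>Z\<in>Lp 1 M F. \<forall>t\<ge>0. \<rho> (\<lambda>\<omega>. t * Z \<omega>) = t * \<rho> Z)"

definition risk_subdifferential ::
  "'w measure \<Rightarrow> 'w measure \<Rightarrow> (('w \<Rightarrow> real) \<Rightarrow> real) \<Rightarrow> ('w \<Rightarrow> real) \<Rightarrow> ('w \<Rightarrow> real) set" where
  "risk_subdifferential M F \<rho> Z\<^sub>0 =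
     {\<zeta> \<in> Linf M F. \<forall>Z\<in>Lp 1 M F. \<rho> Z\<^sub>0 + (\<integral>\<omega>. \<zeta> \<omega> * (Z \<omega> - Z\<^sub>0 \<omega>) \<partial>M) \<le> \<rho> Z}"

end

theory Submission
  imports Defs
begin

text \<open>Subadditivity of \<open>\<rho>\<close> and optimality give \<open>0 \<le> \<rho> (J (u\<^sup>* + t h)) - \<rho> (J u\<^sup>*) \<le> \<rho> (J (u\<^sup>* + t h) - J u\<^sup>*)\<close>.
  Since a finite coherent risk measure on \<open>L\<^sup>1\<close> is automatically bounded, dividing by \<open>t \<rightarrow> 0\<close>
  yields \<open>0 \<le> \<rho> (D h)\<close> for the derivative \<open>D\<close> of \<open>J\<close> at \<open>u\<^sup>*\<close>. Hence \<open>\<rho>\<close> is nonnegative on the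
  subspace of all \<open>D h\<close>, and by Hahn-Banach there is a linear functional below \<open>\<rho>\<close> that vanishes
  there. It is positive and bounded, so it is integration against some \<open>\<zeta>\<close> in \<open>L\<^sup>\<infinity>\<close>, which is the
  required subgradient after an application of Fubini's theorem.\<close>

section \<open>The Hahn-Banach theorem on function spaces\<close>

text \<open>The vector space is a set of functions, not a type of almost-everywhere classes, so that
  the integrable functions of a fixed measure form an instance. Only the pointwise linear structure
  is used; no norm or topology enters.\<close>

locale function_space =
  fixes V :: "('a \<Rightarrow> real) set"
  assumes zero: "(\<lambda>x. 0) \<in> V"
    and add: "f \<in> V \<Longrightarrow> g \<in> V \<Longrightarrow> (\<lambda>x. f x + g x) \<in> V"
    and scale: "f \<in> V \<Longrightarrow> (\<lambda>x. c * f x) \<in> V"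
begin

definition sublinear :: "(('a \<Rightarrow> real) \<Rightarrow> real) \<Rightarrow> bool" where
  "sublinear q \<longleftrightarrow>
     (\<forall>f\<in>V. \<forall>g\<in>V. q (\<lambda>x. f x + g x) \<le> q f + q g) \<and>
     (\<forall>f\<in>V. \<forall>c\<ge>0. q (\<lambda>x. c * f x) = c * q f)"

lemma sublinear_add: "sublinear q \<Longrightarrow> f \<in> V \<Longrightarrow> g \<in> V \<Longrightarrow> q (\<lambda>x. f x + g x) \<le> q f + q g"
  and sublinear_scale: "sublinear q \<Longrightarrow> f \<in> V \<Longrightarrow> 0 \<le> c \<Longrightarrow> q (\<lambda>x. c * f x) = c * q f"
  by (auto simp: sublinear_def)

lemma uminus: "f \<in> V \<Longrightarrow> (\<lambda>x. - f x) \<in> V"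
  using scale[of f "-1"] by simp

lemma sublinear_zero: "sublinear q \<Longrightarrow> q (\<lambda>x. 0) = 0"
  using sublinear_scale[of q "\<lambda>x. 0" 0] zero by simp

lemma sublinear_uminus: "sublinear q \<Longrightarrow> f \<in> V \<Longrightarrow> - q (\<lambda>x. - f x) \<le> q f"
  using sublinear_add[of q f "\<lambda>x. - f x"] uminus sublinear_zero[of q] by simp

text \<open>For positive \<open>c\<close> one inequality suffices: applied with factor
  \<open>1 / c\<close> to the function \<open>c * f\<close> it yields the reverse one. For the
  infima formed below, this one inequality is the natural one to check.\<close>

lemma sublinearI:
  assumes "\<And>f g. f \<in> V \<Longrightarrow> g \<in> V \<Longrightarrow> q (\<lambda>x. f x + g x) \<le> q f + q g"
    and le: "\<And>f c. f \<in> V \<Longrightarrow> 0 < c \<Longrightarrow> q (\<lambda>x. c * f x) \<le> c * q f"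
    and "q (\<lambda>x. 0) = 0"
  shows "sublinear q"
proof -
  have "q (\<lambda>x. c * f x) = c * q f" if f: "f \<in> V" and "0 \<le> c" for f c
  proof (cases "c = 0")
    case False
    with \<open>0 \<le> c\<close> have c: "0 < c" by simp
    have "q (\<lambda>x. (1 / c) * (c * f x)) \<le> (1 / c) * q (\<lambda>x. c * f x)"
      using c by (intro le scale f) auto
    then have "c * q f \<le> q (\<lambda>x. c * f x)"
      using c by (simp add: field_simps)
    with le[OF f c] show ?thesis by simp
  qed (use assms(3) in simp)
  with assms(1) show ?thesis by (auto simp: sublinear_def)
qed

text \<open>Lowering \<open>q\<close> along a cone of pairs \<open>(s, a)\<close> with \<open>a \<le> q s\<close> forces every linear functional
  below the result to be at least \<open>a\<close> at \<open>s\<close>. This covers both the initial constraint of the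
  Hahn-Banach argument and the proof that minimal sublinear functionals are additive.\<close>

definition lowering :: "(('a \<Rightarrow> real) \<times> real) set \<Rightarrow> (('a \<Rightarrow> real) \<Rightarrow> real) \<Rightarrow> ('a \<Rightarrow> real) \<Rightarrow> real" where
  "lowering K q f = (INF (s, a)\<in>K. q (\<lambda>x. f x + s x) - a)"

definition constraint_cone :: "(('a \<Rightarrow> real) \<Rightarrow> real) \<Rightarrow> (('a \<Rightarrow> real) \<times> real) set \<Rightarrow> bool" where
  "constraint_cone q K \<longleftrightarrow>
     ((\<lambda>x. 0), 0) \<in> K \<and>
     (\<forall>(s, a)\<in>K. s \<in> V \<and> a \<le> q s \<and> (\<forall>c>0. ((\<lambda>x. c * s x), c * a) \<in> K) \<and>
        (\<forall>(t, b)\<in>K. ((\<lambda>x. s x + t x), a + b) \<in> K))"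

lemma constraint_cone_add:
  assumes "constraint_cone q K" "(s, a) \<in> K" "(t, b) \<in> K"
  shows "((\<lambda>x. s x + t x), a + b) \<in> K"
  using bspec[OF assms(1)[unfolded constraint_cone_def, THEN conjunct2] assms(2)] assms(3) by blast

lemma constraint_cone_scale:
  assumes "constraint_cone q K" "(s, a) \<in> K" "0 < c"
  shows "((\<lambda>x. c * s x), c * a) \<in> K"
  using bspec[OF assms(1)[unfolded constraint_cone_def, THEN conjunct2] assms(2)] assms(3) by blast

section \<open>Lowering a sublinear functional along a cone of constraints\<close>

context
  fixes q K
  assumes q: "sublinear q" and K: "constraint_cone q K"
begin

text \<open>Makes the infimum in \<open>lowering\<close> meaningful: the lower bound does not
  involve the pair \<open>(s, a)\<close>. It is subadditivity for the splitting of \<open>s\<close>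
  into \<open>f + s\<close> and \<open>- f\<close>, combined with
  \<open>a \<le> q s\<close>.\<close>

lemma lowering_bound:
  assumes "(s, a) \<in> K" "f \<in> V"
  shows "- q (\<lambda>x. - f x) \<le> q (\<lambda>x. f x + s x) - a"
proof -
  have s: "s \<in> V" "a \<le> q s" using K assms(1) by (auto simp: constraint_cone_def)
  have "q (\<lambda>x. (f x + s x) + - f x) \<le> q (\<lambda>x. f x + s x) + q (\<lambda>x. - f x)"
    by (intro sublinear_add q add uminus s assms)
  with s show ?thesis by simp
qed

lemma lowering_le:
  assumes "(s, a) \<in> K" "f \<in> V"
  shows "lowering K q f \<le> q (\<lambda>x. f x + s x) - a"
proof -
  have "bdd_below ((\<lambda>(s, a). q (\<lambda>x. f x + s x) - a) ` K)"
    using lowering_bound[OF _ assms(2)] by (intro bdd_belowI2[of _ "- q (\<lambda>x. - f x)"]) auto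
  from cINF_lower[OF this assms(1)] show ?thesis by (simp add: lowering_def)
qed

lemma lowering_greatest:
  assumes "\<And>s a. (s, a) \<in> K \<Longrightarrow> m \<le> q (\<lambda>x. f x + s x) - a"
  shows "m \<le> lowering K q f"
  unfolding lowering_def using K assms by (intro cINF_greatest) (auto simp: constraint_cone_def)

lemma lowering_self: "f \<in> V \<Longrightarrow> lowering K q f \<le> q f"
  using lowering_le[of "\<lambda>x. 0" 0 f] K by (simp add: constraint_cone_def)

text \<open>A cone is closed under sums and positive multiples. Hence pairs that compete in the
  infima for \<open>f\<close> and \<open>g\<close> add up to a pair competing for
  \<open>f + g\<close>, and scaled pairs compete for \<open>c * f\<close>.\<close>

lemma sublinear_lowering: "sublinear (lowering K q)"
proof (rule sublinearI)
  fix f g assume f: "f \<in> V" and g: "g \<in> V"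
  \<comment> \<open>One competitor is moved to the left-hand side so that the two infima can be
    taken one after the other, first over \<open>(s, a)\<close> and then over
    \<open>(t, b)\<close>.\<close>
  have *: "lowering K q (\<lambda>x. f x + g x) - (q (\<lambda>x. g x + t x) - b) \<le> q (\<lambda>x. f x + s x) - a"
    if sa: "(s, a) \<in> K" and tb: "(t, b) \<in> K" for s a t b
  proof -
    have V: "s \<in> V" "t \<in> V" using K sa tb by (auto simp: constraint_cone_def)
    have "((\<lambda>x. s x + t x), a + b) \<in> K"
      by (rule constraint_cone_add[OF K sa tb])
    then have "lowering K q (\<lambda>x. f x + g x) \<le> q (\<lambda>x. (f x + g x) + (s x + t x)) - (a + b)"
      by (intro lowering_le add f g)
    also have "(\<lambda>x. (f x + g x) + (s x + t x)) = (\<lambda>x. (f x + s x) + (g x + t x))"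
      by (simp add: add_ac)
    also have "q \<dots> \<le> q (\<lambda>x. f x + s x) + q (\<lambda>x. g x + t x)"
      by (intro sublinear_add q add f g V)
    finally show ?thesis by simp
  qed
  have "lowering K q (\<lambda>x. f x + g x) - lowering K q f \<le> q (\<lambda>x. g x + t x) - b"
    if "(t, b) \<in> K" for t b
    using lowering_greatest[OF *[OF _ that]] by (simp add: algebra_simps)
  from lowering_greatest[OF this]
  show "lowering K q (\<lambda>x. f x + g x) \<le> lowering K q f + lowering K q g" by simp
next
  fix f and c :: real assume f: "f \<in> V" and c: "0 < c"
  have "lowering K q (\<lambda>x. c * f x) / c \<le> q (\<lambda>x. f x + s x) - a" if sa: "(s, a) \<in> K" for s a
  proof -
    have s: "s \<in> V" using K sa by (auto simp: constraint_cone_def)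
    have "lowering K q (\<lambda>x. c * f x) \<le> q (\<lambda>x. c * f x + c * s x) - c * a"
      by (intro lowering_le constraint_cone_scale[OF K] sa c scale f)
    also have "q (\<lambda>x. c * f x + c * s x) = c * q (\<lambda>x. f x + s x)"
      using sublinear_scale[OF q add[OF f s(1)], of c] c by (simp add: distrib_left)
    finally show ?thesis using c by (simp add: field_simps)
  qed
  from lowering_greatest[OF this]
  show "lowering K q (\<lambda>x. c * f x) \<le> c * lowering K q f" using c by (simp add: field_simps)
next
  have "0 \<le> lowering K q (\<lambda>x. 0)"
    by (rule lowering_greatest) (use K in \<open>auto simp: constraint_cone_def\<close>)
  with lowering_self[OF zero] sublinear_zero[OF q]
  show "lowering K q (\<lambda>x. 0) = 0" by simp
qed

end

section \<open>Minimal sublinear functionals by Zorn's lemma\<close>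

text \<open>Infima of sublinear functionals need not be subadditive in general. In a chain, any two
  members \<open>q\<close> and \<open>r\<close> can be replaced by the smaller one, which then
  bounds both summands at once. Domination by \<open>p\<close> keeps the infimum finite, since
  \<open>- p (- f) \<le> - q (- f) \<le> q f\<close>.\<close>

lemma sublinear_INF_chain:
  assumes ne: "C \<noteq> {}" and sub: "\<And>q. q \<in> C \<Longrightarrow> sublinear q"
    and dom: "\<And>q f. q \<in> C \<Longrightarrow> f \<in> V \<Longrightarrow> q f \<le> p f"
    and chain: "\<And>q r. q \<in> C \<Longrightarrow> r \<in> C \<Longrightarrow> q \<le> r \<or> r \<le> q"
  shows "sublinear (\<lambda>f. INF q\<in>C. q f)"
    and "\<And>f q. f \<in> V \<Longrightarrow> q \<in> C \<Longrightarrow> (INF q\<in>C. q f) \<le> q f"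
proof -
  have bdd: "bdd_below ((\<lambda>q. q f) ` C)" if "f \<in> V" for f
  proof (rule bdd_belowI2)
    fix q assume q: "q \<in> C"
    show "- p (\<lambda>x. - f x) \<le> q f"
      using sublinear_uminus[OF sub[OF q] that] dom[OF q uminus[OF that]] by simp
  qed
  show lower: "(INF q\<in>C. q f) \<le> q f" if "f \<in> V" "q \<in> C" for f q
    by (rule cINF_lower[OF bdd[OF that(1)] that(2)])
  show "sublinear (\<lambda>f. INF q\<in>C. q f)"
  proof (rule sublinearI)
    fix f g assume f: "f \<in> V" and g: "g \<in> V"
    have *: "(INF q\<in>C. q (\<lambda>x. f x + g x)) - r g \<le> q f" if q: "q \<in> C" and r: "r \<in> C" for q r
    proof -
      obtain s where s: "s \<in> C" "s \<le> q" "s \<le> r" using chain[OF q r] q r by auto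
      have "(INF q\<in>C. q (\<lambda>x. f x + g x)) \<le> s (\<lambda>x. f x + g x)"
        by (intro lower add f g s)
      also have "\<dots> \<le> s f + s g" by (intro sublinear_add sub s f g)
      also have "\<dots> \<le> q f + r g" using s by (intro add_mono) (auto simp: le_fun_def)
      finally show ?thesis by simp
    qed
    have "(INF q\<in>C. q (\<lambda>x. f x + g x)) - (INF q\<in>C. q f) \<le> r g" if "r \<in> C" for r
    proof -
      have "(INF q\<in>C. q (\<lambda>x. f x + g x)) - r g \<le> (INF q\<in>C. q f)"
        by (rule cINF_greatest[OF ne *[OF _ that]])
      then show ?thesis by simp
    qed
    then have "(INF q\<in>C. q (\<lambda>x. f x + g x)) - (INF q\<in>C. q f) \<le> (INF q\<in>C. q g)"
      by (rule cINF_greatest[OF ne])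
    then show "(INF q\<in>C. q (\<lambda>x. f x + g x)) \<le> (INF q\<in>C. q f) + (INF q\<in>C. q g)" by simp
  next
    fix f and c :: real assume f: "f \<in> V" and c: "0 < c"
    have "(INF q\<in>C. q (\<lambda>x. c * f x)) / c \<le> q f" if "q \<in> C" for q
      using lower[OF scale[OF f, of c] that] sublinear_scale[OF sub[OF that] f, of c] c
      by (simp add: field_simps)
    then have "(INF q\<in>C. q (\<lambda>x. c * f x)) / c \<le> (INF q\<in>C. q f)"
      by (rule cINF_greatest[OF ne])
    then show "(INF q\<in>C. q (\<lambda>x. c * f x)) \<le> c * (INF q\<in>C. q f)" using c by (simp add: field_simps)
  next
    have "(\<lambda>q. q (\<lambda>x. 0)) ` C = {0}" using ne sub sublinear_zero by force
    then show "(INF q\<in>C. q (\<lambda>x. 0)) = 0" by simp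
  qed
qed

text \<open>Chains are bounded below by their infima, so a minimal functional exists below
  \<open>p\<close>. It is wanted because minimality forces additivity, as the next theorem
  shows.\<close>

lemma minimal_sublinear:
  assumes p: "sublinear p"
  obtains q where "sublinear q" "\<And>f. f \<in> V \<Longrightarrow> q f \<le> p f"
    "\<And>r. sublinear r \<Longrightarrow> \<forall>f\<in>V. r f \<le> q f \<Longrightarrow> \<forall>f\<in>V. r f = q f"
proof -
  \<comment> \<open>Normalising functionals to \<open>0\<close> off \<open>V\<close> makes the pointwise order antisymmetric.\<close>
  define tr :: "(('a \<Rightarrow> real) \<Rightarrow> real) \<Rightarrow> ('a \<Rightarrow> real) \<Rightarrow> real"
    where "tr q f = (if f \<in> V then q f else 0)" for q f
  have tr: "sublinear (tr q) = sublinear q" for q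
    by (auto simp: sublinear_def tr_def add scale)
  define A where "A = {q. sublinear q \<and> (\<forall>f\<in>V. q f \<le> p f) \<and> (\<forall>f. f \<notin> V \<longrightarrow> q f = 0)}"
  have trA: "tr q \<in> A" if "sublinear q" "\<And>f. f \<in> V \<Longrightarrow> q f \<le> p f" for q
    using that tr by (auto simp: A_def tr_def)
  have "\<exists>m\<in>A. \<forall>a\<in>A. a \<le> m \<longrightarrow> a = m"
  \<comment> \<open>The order is read backwards: maximal elements become minimal ones, and the
    required bounds of chains become lower bounds.\<close>
  proof (rule predicate_Zorn[where P = "\<lambda>a b. b \<le> a"])
    show "partial_order_on A (relation_of (\<lambda>a b. b \<le> a) A)"
      by (auto simp: partial_order_on_def preorder_on_def refl_on_def trans_def antisym_def
          relation_of_def intro: order_trans)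
  next
    fix C assume "C \<in> Chains (relation_of (\<lambda>a b. b \<le> a) A)"
    then have CA: "C \<subseteq> A" and ch: "\<And>q r. q \<in> C \<Longrightarrow> r \<in> C \<Longrightarrow> q \<le> r \<or> r \<le> q"
      by (auto simp: Chains_def relation_of_def)
    show "\<exists>u\<in>A. \<forall>a\<in>C. u \<le> a"
    proof (cases "C = {}")
      case True
      then show ?thesis using trA[OF p] by auto
    next
      case False
      have sub: "\<And>q. q \<in> C \<Longrightarrow> sublinear q" and dom: "\<And>q f. q \<in> C \<Longrightarrow> f \<in> V \<Longrightarrow> q f \<le> p f"
        and off: "\<And>q f. q \<in> C \<Longrightarrow> f \<notin> V \<Longrightarrow> q f = 0"
        using CA by (auto simp: A_def)
      have INF: "sublinear (\<lambda>f. INF q\<in>C. q f)" "\<And>f q. f \<in> V \<Longrightarrow> q \<in> C \<Longrightarrow> (INF q\<in>C. q f) \<le> q f"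
        by (rule sublinear_INF_chain(1)[of C p] sublinear_INF_chain(2)[of C p];
            use False sub dom ch in auto)+
      obtain q0 where q0: "q0 \<in> C" using False by auto
      have "tr (\<lambda>f. INF q\<in>C. q f) \<in> A"
        by (rule trA[OF INF(1)]) (use INF(2)[OF _ q0] dom[OF q0] in \<open>auto intro: order_trans\<close>)
      moreover have "tr (\<lambda>f. INF q\<in>C. q f) \<le> q" if "q \<in> C" for q
        using INF(2) that off[OF that] by (auto simp: le_fun_def tr_def)
      ultimately show ?thesis by blast
    qed
  qed
  then obtain m where m: "m \<in> A" "\<And>a. a \<in> A \<Longrightarrow> a \<le> m \<Longrightarrow> a = m" by auto
  show thesis
  proof (rule that[of m])
    show "sublinear m" "\<And>f. f \<in> V \<Longrightarrow> m f \<le> p f" using m by (auto simp: A_def)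
    fix r assume r: "sublinear r" "\<forall>f\<in>V. r f \<le> m f"
    have "tr r = m"
    proof (rule m(2))
      show "tr r \<in> A" by (rule trA[OF r(1)]) (use r m in \<open>auto simp: A_def intro: order_trans\<close>)
      show "tr r \<le> m" using r m by (auto simp: A_def le_fun_def tr_def)
    qed
    then show "\<forall>f\<in>V. r f = m f" by (auto simp: tr_def)
  qed
qed

text \<open>The functional is a minimal sublinear one below \<open>lowering K p\<close>. At
  \<open>- s\<close> the pair \<open>(s, a)\<close> cancels the argument, so the value there is at
  most \<open>- a\<close>, which is the constraint at \<open>s\<close>. The usual separation from a
  subspace is the case of pairs \<open>(s, 0)\<close>: a linear functional that is nonnegative on a
  subspace vanishes on it.\<close>

theorem hahn_banach:
  assumes p: "sublinear p" and K: "constraint_cone p K"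
  obtains l where "\<And>f g. f \<in> V \<Longrightarrow> g \<in> V \<Longrightarrow> l (\<lambda>x. f x + g x) = l f + l g"
    "\<And>f c. f \<in> V \<Longrightarrow> l (\<lambda>x. c * f x) = c * l f"
    "\<And>f. f \<in> V \<Longrightarrow> l f \<le> p f"
    "\<And>s a. (s, a) \<in> K \<Longrightarrow> a \<le> l s"
proof -
  obtain q where q: "sublinear q" and qp: "\<And>f. f \<in> V \<Longrightarrow> q f \<le> lowering K p f"
    and min: "\<And>r. sublinear r \<Longrightarrow> \<forall>f\<in>V. r f \<le> q f \<Longrightarrow> \<forall>f\<in>V. r f = q f"
    using minimal_sublinear[OF sublinear_lowering[OF p K]] by blast
  have q_add: "q (\<lambda>x. f x + g x) = q f + q g" if f: "f \<in> V" and g: "g \<in> V" for f g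
  proof -
    \<comment> \<open>The ray through \<open>(g, q g)\<close>. Lowering \<open>q\<close> along it
      gives a sublinear functional below \<open>q\<close>, which equals \<open>q\<close> by
      minimality. The pair with \<open>t = 1\<close> then reads
      \<open>q f + q g \<le> q (f + g)\<close>, the missing half of additivity.\<close>
    define R where "R = {((\<lambda>x. t * g x), t * q g) | t. 0 \<le> t}"
    have gR: "((\<lambda>x. t * g x), t * q g) \<in> R" if "0 \<le> t" for t
      using that by (auto simp: R_def)
    have R: "constraint_cone q R"
      unfolding constraint_cone_def
    proof (intro conjI ballI, goal_cases)
      case 1
      then show ?case using gR[of 0] by simp
    next
      case (2 z)
      then obtain t where t: "z = ((\<lambda>x. t * g x), t * q g)" "0 \<le> t" by (auto simp: R_def)
      have "((\<lambda>x. t * g x + u * g x), t * q g + u * q g) \<in> R" if "0 \<le> u" for u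
        using gR[of "t + u"] t that by (simp add: distrib_right)
      moreover have "((\<lambda>x. c * (t * g x)), c * (t * q g)) \<in> R" if "0 < c" for c
        using gR[of "c * t"] t that by (simp add: mult.assoc)
      ultimately show ?case
        using t scale[OF g] sublinear_scale[OF q g] by (auto simp: R_def)
    qed
    have "lowering R q f = q f"
      using min[OF sublinear_lowering[OF q R]] lowering_self[OF q R] f by blast
    moreover have "lowering R q f \<le> q (\<lambda>x. f x + g x) - q g"
      using lowering_le[OF q R _ f, of g "q g"] gR[of 1] by simp
    ultimately show ?thesis using sublinear_add[OF q f g] by simp
  qed
  have q_uminus: "q (\<lambda>x. - f x) = - q f" if "f \<in> V" for f
    using q_add[OF that uminus[OF that]] sublinear_zero[OF q] by simp
  show thesis
  proof (rule that[of q])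
    show "q (\<lambda>x. c * f x) = c * q f" if f: "f \<in> V" for f c
    proof (cases "0 \<le> c")
      case True
      then show ?thesis by (rule sublinear_scale[OF q f])
    next
      case False
      then have "q (\<lambda>x. - c * f x) = - c * q f" by (intro sublinear_scale q f) auto
      with q_uminus[OF scale[OF f, of c]] show ?thesis by simp
    qed
    show "q f \<le> p f" if "f \<in> V" for f
      using qp[OF that] lowering_self[OF p K that] by simp
    show "a \<le> q s" if sa: "(s, a) \<in> K" for s a
    proof -
      have s: "s \<in> V" using K sa by (auto simp: constraint_cone_def)
      have "q (\<lambda>x. - s x) \<le> p (\<lambda>x. - s x + s x) - a"
        using qp[OF uminus[OF s]] lowering_le[OF p K sa uminus[OF s]] by simp
      with q_uminus[OF s] sublinear_zero[OF p] show ?thesis by simp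
    qed
  qed (rule q_add)
qed

end

section \<open>Positive functionals on integrable functions\<close>

text \<open>The positive part of the duality between L^1 and L^infinity. The set function given by
  \<open>l\<close> on indicators is a finite measure, dominated by \<open>C\<close> times the
  measure \<open>M\<close>, so Radon-Nikodym provides a density with values in \<open>[0, C]\<close>
  almost everywhere. Agreement on indicators extends to all integrable functions by continuity in
  L^1.\<close>

lemma (in finite_measure) positive_functional_density:
  fixes l :: "('a \<Rightarrow> real) \<Rightarrow> real"
  assumes add: "\<And>f g. integrable M f \<Longrightarrow> integrable M g \<Longrightarrow> l (\<lambda>x. f x + g x) = l f + l g"
    and scale: "\<And>f c. integrable M f \<Longrightarrow> l (\<lambda>x. c * f x) = c * l f"
    and pos: "\<And>f. integrable M f \<Longrightarrow> AE x in M. 0 \<le> f x \<Longrightarrow> 0 \<le> l f"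
    and bound: "\<And>f. integrable M f \<Longrightarrow> l f \<le> C * (\<integral>x. \<bar>f x\<bar> \<partial>M)"
  obtains z where "z \<in> borel_measurable M" "AE x in M. 0 \<le> z x \<and> z x \<le> C"
    "\<And>f. integrable M f \<Longrightarrow> l f = (\<integral>x. z x * f x \<partial>M)"
proof -
  have ind: "integrable M (indicator A :: 'a \<Rightarrow> real)" if "A \<in> sets M" for A
    using that by (simp add: less_top[symmetric])
  have ind_nonneg: "0 \<le> l (indicator A)" if "A \<in> sets M" for A
    by (rule pos[OF ind[OF that]]) simp
  have ind_bound: "l (indicator A) \<le> C * measure M A" if "A \<in> sets M" for A
    using bound[OF ind[OF that]] that by simp
  have diff: "l (\<lambda>x. f x - g x) = l f - l g" if "integrable M f" "integrable M g" for f g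
    using add[of f "\<lambda>x. -1 * g x"] scale[of g "-1"] that by simp
  define \<nu> where "\<nu> = measure_of (space M) (sets M) (\<lambda>A. ennreal (l (indicator A)))"
  have additive: "additive (sets M) (\<lambda>A. ennreal (l (indicator A)))"
    unfolding additive_def
  proof (intro ballI impI)
    fix A B assume AB: "A \<in> sets M" "B \<in> sets M" "A \<inter> B = {}"
    have "indicator (A \<union> B) = (\<lambda>x. indicator A x + indicator B x :: real)"
      using AB(3) by (auto simp: fun_eq_iff indicator_def)
    then have "l (indicator (A \<union> B)) = l (indicator A) + l (indicator B)"
      by (simp only: add[OF ind[OF AB(1)] ind[OF AB(2)]])
    then show "ennreal (l (indicator (A \<union> B))) = ennreal (l (indicator A)) + ennreal (l (indicator B))"
      by (simp only: ennreal_plus[OF ind_nonneg[OF AB(1)] ind_nonneg[OF AB(2)]])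
  qed
  have zero: "l (\<lambda>x. 0) = 0" using scale[of "\<lambda>x. 0" 0] by simp
  have "indicator {} = (\<lambda>x::'a. 0 :: real)" by (rule ext) simp
  with zero have "l (indicator {}) = 0" by (simp only:)
  then have positive: "positive (sets M) (\<lambda>A. ennreal (l (indicator A)))"
    by (simp add: positive_def)
  \<comment> \<open>For a finitely additive finite set function, continuity at the empty set is
    enough, and this follows from the bound by \<open>C * measure M A\<close>.\<close>
  have "countably_additive (sets M) (\<lambda>A. ennreal (l (indicator A)))"
  proof (rule sets.empty_continuous_imp_countably_additive[OF positive additive])
    fix A :: "nat \<Rightarrow> 'a set" assume A: "range A \<subseteq> sets M" "decseq A" "(\<Inter>i. A i) = {}"
    have "(\<lambda>i. C * measure M (A i)) \<longlonglongrightarrow> C * 0"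
      using finite_Lim_measure_decseq[OF A(1,2)] A(3) by (intro tendsto_mult) auto
    then have "(\<lambda>i. C * measure M (A i)) \<longlonglongrightarrow> 0" by simp
    moreover have "\<forall>\<^sub>F i in sequentially. norm (l (indicator (A i))) \<le> C * measure M (A i)"
      using A(1) ind_nonneg ind_bound by (intro always_eventually allI) (simp add: subset_iff)
    ultimately have "(\<lambda>i. l (indicator (A i))) \<longlonglongrightarrow> 0" by (rule Lim_null_comparison[rotated])
    from tendsto_ennrealI[OF this] show "(\<lambda>i. ennreal (l (indicator (A i)))) \<longlonglongrightarrow> 0" by simp
  qed simp
  then have \<nu>: "emeasure \<nu> A = ennreal (l (indicator A))" if "A \<in> sets M" for A
    unfolding \<nu>_def by (rule emeasure_measure_of_sigma[OF sets.sigma_algebra_axioms positive _ that])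
  have [simp]: "sets \<nu> = sets M" by (simp add: \<nu>_def)
  have "absolutely_continuous M \<nu>"
    unfolding absolutely_continuous_def
  proof
    fix A assume A: "A \<in> null_sets M"
    then have "l (indicator A) \<le> 0" using ind_bound[of A] by (simp add: measure_eq_0_null_sets null_setsD2)
    with A show "A \<in> null_sets \<nu>" by (auto simp: null_sets_def \<nu> ennreal_neg)
  qed
  from Radon_Nikodym[OF this] obtain f where f [measurable]: "f \<in> borel_measurable M"
    and f\<nu>: "density M f = \<nu>" by auto
  have f_int: "(\<integral>\<^sup>+x. f x * indicator A x \<partial>M) = ennreal (l (indicator A))" if "A \<in> sets M" for A
    using emeasure_density[OF f that] \<nu>[OF that] by (simp add: f\<nu>)
  \<comment> \<open>\<open>enn2real\<close> sends infinity to 0, so \<open>z\<close> is nonnegative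
    everywhere. It agrees with \<open>f\<close> almost everywhere because the integral of
    \<open>f\<close> is finite.\<close>
  define z where "z x = enn2real (f x)" for x
  have z [measurable]: "z \<in> borel_measurable M" by (simp add: z_def[abs_def])
  have "(\<integral>\<^sup>+x. f x \<partial>M) = (\<integral>\<^sup>+x. f x * indicator (space M) x \<partial>M)"
    by (intro nn_integral_cong) simp
  then have fin: "(\<integral>\<^sup>+x. f x \<partial>M) < \<infinity>" using f_int[of "space M"] by simp
  then have "AE x in M. f x \<noteq> \<infinity>" by (intro nn_integral_PInf_AE) auto
  then have zf: "AE x in M. ennreal (z x) = f x"
    by eventually_elim (simp add: z_def less_top)
  have z_int: "integrable M z"
  proof (rule integrableI_nonneg)
    have "(\<integral>\<^sup>+x. ennreal (z x) \<partial>M) = (\<integral>\<^sup>+x. f x \<partial>M)" using zf by (rule nn_integral_cong_AE)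
    with fin show "(\<integral>\<^sup>+x. ennreal (z x) \<partial>M) < \<infinity>" by simp
  qed (simp_all add: z_def)
  have z_ind: "(\<integral>x. z x * indicator A x \<partial>M) = l (indicator A)" if [measurable]: "A \<in> sets M" for A
  proof -
    have "(\<integral>x. z x * indicator A x \<partial>M) = enn2real (\<integral>\<^sup>+x. ennreal (z x * indicator A x) \<partial>M)"
      by (intro integral_eq_nn_integral) (auto simp: z_def)
    also have "(\<integral>\<^sup>+x. ennreal (z x * indicator A x) \<partial>M) = (\<integral>\<^sup>+x. f x * indicator A x \<partial>M)"
    proof (rule nn_integral_cong_AE)
      show "AE x in M. ennreal (z x * indicator A x) = f x * indicator A x"
        using zf by eventually_elim (simp split: split_indicator)
    qed
    finally show ?thesis using f_int[OF that] ind_nonneg[OF that] by simp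
  qed
  \<comment> \<open>The upper bound is tested on sets: the integral of \<open>C - z\<close> over
    \<open>A\<close> is \<open>C * measure M A - l (indicator A)\<close>, which is nonnegative by
    \<open>bound\<close>.\<close>
  have "AE x in M. 0 \<le> C - z x"
  proof (rule density_nonneg)
    fix A assume A: "A \<in> sets M"
    have "set_lebesgue_integral M A (\<lambda>x. C - z x) = (\<integral>x. C * indicator A x - z x * indicator A x \<partial>M)"
      unfolding set_lebesgue_integral_def by (simp add: algebra_simps)
    also have "\<dots> = C * measure M A - l (indicator A)"
      using A z_int z_ind[OF A] ind[OF A]
      by (subst Bochner_Integration.integral_diff) (auto intro: integrable_real_mult_indicator)
    finally show "0 \<le> set_lebesgue_integral M A (\<lambda>x. C - z x)" using ind_bound[OF A] by simp
  qed (use z_int in simp)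
  then have zC: "AE x in M. 0 \<le> z x \<and> z x \<le> C" by eventually_elim (simp add: z_def)
  have zb: "AE x in M. norm (z x * g x) \<le> norm (C * h x)" if "AE x in M. norm (g x) \<le> norm (h x)" for g h
    using zC that by eventually_elim (auto simp: abs_mult intro!: mult_mono)
  have zg: "integrable M (\<lambda>x. z x * g x)" if "integrable M g" for g
    by (rule Bochner_Integration.integrable_bound[where f = "\<lambda>x. C * g x"])
      (use that zb[of g g] in auto)
  have "l g = (\<integral>x. z x * g x \<partial>M)" if "integrable M g" for g
    using that
  proof (induction rule: integrable_induct)
    case (base A c)
    have "l (\<lambda>x. c * indicator A x) = c * (\<integral>x. z x * indicator A x \<partial>M)"
      using scale[OF ind[OF base(1)], of c] z_ind[OF base(1)] by simp
    also have "\<dots> = (\<integral>x. c * (z x * indicator A x) \<partial>M)" by simp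
    finally show ?case by (simp add: ac_simps)
  next
    case (add f g)
    then show ?case using assms(1) zg by (simp add: distrib_left)
  next
    \<comment> \<open>The approximants satisfy
      \<open>\<bar>s i\<bar> \<le> 2 * \<bar>f\<bar>\<close>. Dominated convergence therefore gives
      both the limit of the integrals against \<open>z\<close> and convergence of \<open>s i\<close>
      to \<open>f\<close> in L^1, with majorant \<open>3 * \<bar>f\<bar>\<close>; the latter carries
      over to \<open>l\<close> through \<open>bound\<close>.\<close>
    case (lim f s)
    note s_int = lim.hyps(1) and s_lim = lim.hyps(2) and s_le = lim.hyps(3) and f_int = lim.hyps(4)
    have "(\<lambda>i. l (s i)) \<longlonglongrightarrow> (\<integral>x. z x * f x \<partial>M)"
      unfolding lim.IH
    proof (rule integral_dominated_convergence)
      show "(\<lambda>x. z x * f x) \<in> borel_measurable M" "(\<lambda>x. z x * s i x) \<in> borel_measurable M" for i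
        using zg[OF f_int] zg[OF s_int] by auto
      show "integrable M (\<lambda>x. norm (C * (2 * norm (f x))))" using f_int by auto
      show "AE x in M. norm (z x * s i x) \<le> norm (C * (2 * norm (f x)))" for i
        using s_le by (intro zb AE_I2) simp
      show "AE x in M. (\<lambda>i. z x * s i x) \<longlonglongrightarrow> z x * f x"
        using s_lim by (intro AE_I2 tendsto_mult_left)
    qed
    moreover have "(\<lambda>i. l (s i)) \<longlonglongrightarrow> l f"
    proof -
      have "(\<lambda>i. \<integral>x. \<bar>s i x - f x\<bar> \<partial>M) \<longlonglongrightarrow> (\<integral>x. 0 \<partial>M)"
      proof (rule integral_dominated_convergence)
        show "(\<lambda>x. \<bar>s i x - f x\<bar>) \<in> borel_measurable M" for i
          using f_int s_int[of i] by auto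
        show "integrable M (\<lambda>x. 3 * \<bar>f x\<bar>)" using f_int by auto
        show "AE x in M. norm \<bar>s i x - f x\<bar> \<le> 3 * \<bar>f x\<bar>" for i
        proof (rule AE_I2)
          fix x assume "x \<in> space M"
          from s_le[OF this, of i] show "norm \<bar>s i x - f x\<bar> \<le> 3 * \<bar>f x\<bar>"
            unfolding real_norm_def by arith
        qed
        show "AE x in M. (\<lambda>i. \<bar>s i x - f x\<bar>) \<longlonglongrightarrow> 0"
          using s_lim by (intro AE_I2 tendsto_rabs_zero LIM_zero)
      qed simp
      from tendsto_mult_left[OF this, of C]
      have lim0: "(\<lambda>i. C * (\<integral>x. \<bar>s i x - f x\<bar> \<partial>M)) \<longlonglongrightarrow> 0" by simp
      \<comment> \<open>\<open>bound\<close> is one-sided, so it is applied to the difference and to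
        its negative.\<close>
      have "norm (l (s i) - l f) \<le> C * (\<integral>x. \<bar>s i x - f x\<bar> \<partial>M)" for i
      proof -
        have "l (s i) - l f \<le> C * (\<integral>x. \<bar>s i x - f x\<bar> \<partial>M)"
          using bound[of "\<lambda>x. s i x - f x"] diff[OF s_int f_int] s_int f_int by simp
        moreover have "l f - l (s i) \<le> C * (\<integral>x. \<bar>f x - s i x\<bar> \<partial>M)"
          using bound[of "\<lambda>x. f x - s i x"] diff[OF f_int s_int] s_int f_int by simp
        ultimately show ?thesis by (simp add: abs_le_iff abs_minus_commute)
      qed
      then have "\<forall>\<^sub>F i in sequentially. norm (l (s i) - l f) \<le> C * (\<integral>x. \<bar>s i x - f x\<bar> \<partial>M)"
        by simp
      from Lim_null_comparison[OF this lim0] have "(\<lambda>i. l (s i) - l f) \<longlonglongrightarrow> 0" .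
      then show ?thesis by (rule LIM_zero_cancel)
    qed
    ultimately show ?case by (rule LIMSEQ_unique[rotated])
  qed
  with z zC show thesis by (rule that)
qed

text \<open>If no bound existed, an integrable series of nonnegative functions would have terms on which
  \<open>p\<close> is arbitrarily large, although \<open>p\<close> of its sum dominates all of them.\<close>

lemma monotone_homogeneous_bounded:
  fixes p :: "('a \<Rightarrow> real) \<Rightarrow> real"
  assumes mono: "\<And>f g. integrable M f \<Longrightarrow> integrable M g \<Longrightarrow> AE x in M. f x \<le> g x \<Longrightarrow> p f \<le> p g"
    and scale: "\<And>f c. integrable M f \<Longrightarrow> 0 \<le> c \<Longrightarrow> p (\<lambda>x. c * f x) = c * p f"
  obtains C where "0 \<le> C" "\<And>f. integrable M f \<Longrightarrow> p f \<le> C * (\<integral>x. \<bar>f x\<bar> \<partial>M)"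
proof (rule ccontr)
  note bounded = that
  assume "\<not> thesis"
  then have "\<exists>f. integrable M f \<and> C * (\<integral>x. \<bar>f x\<bar> \<partial>M) < p f" if "0 \<le> C" for C
    using that bounded by (meson not_le)
  then have "\<exists>f. integrable M f \<and> 4 ^ n * (\<integral>x. \<bar>f x\<bar> \<partial>M) < p f" for n :: nat by simp
  then obtain f where f: "\<And>n. integrable M (f n)" and large: "\<And>n. 4 ^ n * (\<integral>x. \<bar>f n x\<bar> \<partial>M) < p (f n)"
    by metis
  define I where "I n = (\<integral>x. \<bar>f n x\<bar> \<partial>M)" for n
  have zero: "p (\<lambda>x. 0) = 0" using scale[of "\<lambda>x. 0" 0] by simp
  \<comment> \<open>Allows division by \<open>I n\<close>: if it vanished, \<open>f n\<close> would
    be zero almost everywhere and \<open>p (f n)\<close> could not be positive.\<close>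
  have I_pos: "0 < I n" for n
  proof (rule ccontr)
    assume "\<not> 0 < I n"
    moreover have "0 \<le> I n" by (simp add: I_def)
    ultimately have I: "I n = 0" by simp
    then have "AE x in M. f n x = 0"
      using integral_nonneg_eq_0_iff_AE[of M "\<lambda>x. \<bar>f n x\<bar>"] f by (simp add: I_def)
    then have "p (f n) \<le> p (\<lambda>x. 0)" by (intro mono f) auto
    with large[of n] I zero show False by (simp add: I_def)
  qed
  \<comment> \<open>The normalisation gives \<open>Y n\<close> integral \<open>1 / 2 ^ n\<close>,
    which is summable. The growth \<open>4 ^ n\<close> chosen for \<open>f n\<close> still leaves
    \<open>p (Y n)\<close> above \<open>4 ^ n / 2 ^ n = 2 ^ n\<close>.\<close>
  define Y where "Y n x = 1 / (2 ^ n * I n) * \<bar>f n x\<bar>" for n x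
  have Y: "integrable M (Y n)" "(\<integral>x. Y n x \<partial>M) = (1 / 2) ^ n" and Y_nonneg: "0 \<le> Y n x" for n x
    using f I_pos[of n] by (auto simp: Y_def[abs_def] I_def power_one_over)
  have p_Y: "2 ^ n < p (Y n)" for n
  proof -
    have "p (f n) \<le> p (\<lambda>x. \<bar>f n x\<bar>)" by (intro mono integrable_abs f) auto
    with large[of n] have "4 ^ n * I n < p (\<lambda>x. \<bar>f n x\<bar>)" by (simp add: I_def)
    then have "1 / (2 ^ n * I n) * (4 ^ n * I n) < 1 / (2 ^ n * I n) * p (\<lambda>x. \<bar>f n x\<bar>)"
      using I_pos[of n] by (intro mult_strict_left_mono) auto
    moreover have "1 / (2 ^ n * I n) * (4 ^ n * I n) = (4 / 2) ^ n"
      using I_pos[of n] by (simp flip: power_divide)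
    moreover have "p (Y n) = 1 / (2 ^ n * I n) * p (\<lambda>x. \<bar>f n x\<bar>)"
      unfolding Y_def[abs_def] using f I_pos[of n] by (intro scale) auto
    ultimately show ?thesis by simp
  qed
  \<comment> \<open>Where the series diverges, \<open>suminf\<close> carries no information. The
    integrals of the \<open>Y n\<close> have a finite sum, so this happens only on a null set, which
    monotonicity of \<open>p\<close> ignores.\<close>
  have summable: "AE x in M. summable (\<lambda>n. Y n x)"
  proof -
    have "(\<integral>\<^sup>+x. (\<Sum>n. ennreal (Y n x)) \<partial>M) = (\<Sum>n. \<integral>\<^sup>+x. ennreal (Y n x) \<partial>M)"
      using Y by (intro nn_integral_suminf) auto
    also have "\<dots> = (\<Sum>n. ennreal ((1 / 2) ^ n))"
      using Y Y_nonneg by (simp add: nn_integral_eq_integral)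
    also have "\<dots> = ennreal (\<Sum>n. (1 / 2) ^ n)"
      by (intro suminf_ennreal2 summable_geometric) auto
    finally have "AE x in M. (\<Sum>n. ennreal (Y n x)) \<noteq> \<infinity>"
      using Y by (intro nn_integral_PInf_AE) auto
    then show ?thesis
      by eventually_elim (auto intro: summable_suminf_not_top Y_nonneg)
  qed
  have sum_int: "integrable M (\<lambda>x. \<Sum>n. Y n x)"
    using Y Y_nonneg summable by (intro integrable_suminf) (auto intro: summable_geometric)
  have "2 ^ n < p (\<lambda>x. \<Sum>n. Y n x)" for n
  proof -
    have "AE x in M. Y n x \<le> (\<Sum>n. Y n x)"
      using summable
    proof eventually_elim
      case (elim x)
      then show ?case using sum_le_suminf[of "\<lambda>n. Y n x" "{n}"] Y_nonneg by simp
    qed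
    from mono[OF Y(1) sum_int this] p_Y[of n] show ?thesis by simp
  qed
  with real_arch_pow[of 2 "p (\<lambda>x. \<Sum>n. Y n x)"] show False by (auto dest: less_asym)
qed

section \<open>Coherent risk measures\<close>

text \<open>Lets the results for a single measure be applied to \<open>restr_to_subalg M F\<close>.
  Measurability there means measurability with respect to \<open>F\<close>, so the density found
  later is automatically \<open>F\<close>-measurable.\<close>

lemma Lp_1_eq:
  fixes M :: "'a measure"
  assumes "subalgebra M F"
  shows "Lp 1 M F = {Z. integrable (restr_to_subalg M F) Z}"
proof (intro set_eqI iffI)
  fix Z assume "Z \<in> Lp 1 M F"
  then have F: "Z \<in> borel_measurable F" and abs: "integrable M (\<lambda>\<omega>. \<bar>Z \<omega>\<bar>)"
    by (simp_all add: Lp_def)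
  have "integrable M Z"
    by (rule integrable_abs_cancel[OF abs measurable_from_subalg[OF assms F]])
  then show "Z \<in> {Z. integrable (restr_to_subalg M F) Z}"
    using integrable_in_subalg[OF assms F] by simp
next
  fix Z :: "'a \<Rightarrow> real" assume "Z \<in> {Z. integrable (restr_to_subalg M F) Z}"
  then have Z: "integrable (restr_to_subalg M F) Z" by simp
  show "Z \<in> Lp 1 M F"
    using measurable_in_subalg'[OF assms borel_measurable_integrable[OF Z]]
      integrable_abs[OF integrable_from_subalg[OF assms Z]]
    by (simp add: Lp_def)
qed

lemma subalgebra_wiener_filtration:
  assumes "\<And>s. s \<in> {0..t} \<Longrightarrow> W s \<in> borel_measurable M"
  shows "subalgebra M (wiener_filtration M W t)"
proof -
  let ?A = "\<Union>s\<in>{0..t}. {W s -` A \<inter> space M | A. A \<in> sets borel}"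
  have A: "?A \<subseteq> sets M" using assms by (auto intro: measurable_sets)
  then have "?A \<subseteq> Pow (space M)" using sets.space_closed by blast
  with sets.sigma_sets_subset[OF A] show ?thesis
    by (simp add: subalgebra_def wiener_filtration_def space_measure_of_conv)
qed

text \<open>The norm inequality is nonnegativity of the variance of
  \<open>\<bar>Z\<bar>\<close>.\<close>

lemma (in prob_space) square_integrable_L1:
  fixes Z :: "'a \<Rightarrow> real"
  assumes Z: "Z \<in> borel_measurable M" "integrable M (\<lambda>x. (Z x)\<^sup>2)"
  shows "integrable M Z" "(\<integral>x. \<bar>Z x\<bar> \<partial>M) \<le> sqrt (\<integral>x. (Z x)\<^sup>2 \<partial>M)"
proof -
  have le: "\<bar>a\<bar> \<le> 1 + a\<^sup>2" for a :: real
    using zero_le_power2[of "\<bar>a\<bar> - 1"] zero_le_power2[of a]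
    by (simp add: power2_eq_square algebra_simps)
  show int: "integrable M Z"
    by (rule Bochner_Integration.integrable_bound[of _ "\<lambda>x. 1 + (Z x)\<^sup>2"]) (use Z le in auto)
  have "0 \<le> variance (\<lambda>x. \<bar>Z x\<bar>)" by (rule variance_positive)
  also have "\<dots> = (\<integral>x. (Z x)\<^sup>2 \<partial>M) - (\<integral>x. \<bar>Z x\<bar> \<partial>M)\<^sup>2"
    using int Z by (subst variance_eq) auto
  finally show "(\<integral>x. \<bar>Z x\<bar> \<partial>M) \<le> sqrt (\<integral>x. (Z x)\<^sup>2 \<partial>M)" by (intro real_le_rsqrt) simp
qed

locale coherent_risk =
  fixes M F :: "'w measure" and \<rho>
  assumes prob: "prob_space M" and subalg: "subalgebra M F" and coherent: "coherent_risk_measure M F \<rho>"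
begin

declare One_nat_def [simp del]

sublocale function_space "Lp 1 M F"
  unfolding Lp_1_eq[OF subalg] by unfold_locales auto

lemma mono:
  assumes "Z \<in> Lp 1 M F" "Z' \<in> Lp 1 M F" "AE \<omega> in M. Z \<omega> \<le> Z' \<omega>"
  shows "\<rho> Z \<le> \<rho> Z'"
  using coherent assms by (auto simp: coherent_risk_measure_def)

lemma cong:
  assumes "Z \<in> Lp 1 M F" "Z' \<in> Lp 1 M F" "AE \<omega> in M. Z \<omega> = Z' \<omega>"
  shows "\<rho> Z = \<rho> Z'"
proof (rule antisym)
  show "\<rho> Z \<le> \<rho> Z'" by (rule mono) (use assms in auto)
  show "\<rho> Z' \<le> \<rho> Z" by (rule mono) (use assms in auto)
qed

text \<open>Convexity at the midpoint bounds \<open>\<rho>\<close> of half the sum; homogeneity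
  removes the factor \<open>1 / 2\<close>.\<close>

lemma sublinear: "sublinear \<rho>"
proof -
  have hom: "\<rho> (\<lambda>\<omega>. c * Z \<omega>) = c * \<rho> Z" if "Z \<in> Lp 1 M F" "0 \<le> c" for Z c
    using coherent that by (simp add: coherent_risk_measure_def)
  have "\<rho> (\<lambda>\<omega>. Z \<omega> + Z' \<omega>) \<le> \<rho> Z + \<rho> Z'" if Z: "Z \<in> Lp 1 M F" "Z' \<in> Lp 1 M F" for Z Z'
  proof -
    have "\<forall>\<alpha>\<in>{0..1}. \<rho> (\<lambda>\<omega>. \<alpha> * Z \<omega> + (1 - \<alpha>) * Z' \<omega>) \<le> \<alpha> * \<rho> Z + (1 - \<alpha>) * \<rho> Z'"
      using coherent Z by (simp add: coherent_risk_measure_def)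
    from bspec[OF this, of "1 / 2"]
    have "\<rho> (\<lambda>\<omega>. (1 / 2) * (Z \<omega> + Z' \<omega>)) \<le> (1 / 2) * (\<rho> Z + \<rho> Z')"
      by (simp add: distrib_left)
    with hom[OF add[OF Z], of "1 / 2"] show ?thesis by simp
  qed
  with hom show ?thesis by (auto simp: sublinear_def)
qed

text \<open>Continuity of \<open>\<rho>\<close> is a consequence of finiteness, monotonicity and
  homogeneity. Passing to the restricted measure leaves integrals of \<open>F\<close>-measurable
  functions unchanged.\<close>

lemma bounded:
  obtains C where "0 \<le> C" "\<And>Z. Z \<in> Lp 1 M F \<Longrightarrow> \<rho> Z \<le> C * (\<integral>\<omega>. \<bar>Z \<omega>\<bar> \<partial>M)"
proof -
  let ?N = "restr_to_subalg M F"
  obtain C where C: "0 \<le> C" "\<And>Z. integrable ?N Z \<Longrightarrow> \<rho> Z \<le> C * (\<integral>\<omega>. \<bar>Z \<omega>\<bar> \<partial>?N)"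
  proof (rule monotone_homogeneous_bounded[of ?N \<rho>])
    show "\<rho> Z \<le> \<rho> Z'" if "integrable ?N Z" "integrable ?N Z'" "AE \<omega> in ?N. Z \<omega> \<le> Z' \<omega>" for Z Z'
      by (rule mono) (use that AE_restr_to_subalg[OF subalg] in \<open>auto simp: Lp_1_eq[OF subalg]\<close>)
    show "\<rho> (\<lambda>\<omega>. c * Z \<omega>) = c * \<rho> Z" if "integrable ?N Z" "0 \<le> c" for Z c
      using sublinear_scale[OF sublinear] that by (simp add: Lp_1_eq[OF subalg])
  qed blast
  show thesis
  proof (rule that[OF C(1)])
    fix Z assume "Z \<in> Lp 1 M F"
    then show "\<rho> Z \<le> C * (\<integral>\<omega>. \<bar>Z \<omega>\<bar> \<partial>M)"
      using C(2)[of Z] integral_subalgebra2[OF subalg, of "\<lambda>\<omega>. \<bar>Z \<omega>\<bar>"]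
      by (simp add: Lp_1_eq[OF subalg] measurable_in_subalg'[OF subalg])
  qed
qed

text \<open>Separation of the subspace \<open>S\<close>: a linear functional below
  \<open>\<rho>\<close> that vanishes on \<open>S\<close> is represented by a bounded density
  \<zeta>. Since \<open>\<rho>\<close> is 0 at the zero function, lying below \<open>\<rho>\<close>
  is exactly the subgradient inequality at 0.\<close>

theorem subgradient_annihilating:
  assumes S: "S \<subseteq> Lp 1 M F" "(\<lambda>\<omega>. 0) \<in> S"
    and S_add: "\<And>s t. s \<in> S \<Longrightarrow> t \<in> S \<Longrightarrow> (\<lambda>\<omega>. s \<omega> + t \<omega>) \<in> S"
    and S_scale: "\<And>s c. s \<in> S \<Longrightarrow> (\<lambda>\<omega>. c * s \<omega>) \<in> S"
    and nonneg: "\<And>s. s \<in> S \<Longrightarrow> 0 \<le> \<rho> s"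
  obtains \<zeta> where "\<zeta> \<in> risk_subdifferential M F \<rho> (\<lambda>\<omega>. 0)" "\<And>s. s \<in> S \<Longrightarrow> (\<integral>\<omega>. \<zeta> \<omega> * s \<omega> \<partial>M) = 0"
proof -
  let ?N = "restr_to_subalg M F"
  interpret N: prob_space ?N by (rule prob_space_restr_to_subalg[OF subalg prob])
  \<comment> \<open>Every \<open>s\<close> in \<open>S\<close> enters with threshold
    \<open>0\<close>, which is admissible because \<open>\<rho>\<close> is nonnegative on
    \<open>S\<close>.\<close>
  have "constraint_cone \<rho> (S \<times> {0})"
    unfolding constraint_cone_def using S S_add S_scale nonneg by auto
  from hahn_banach[OF sublinear this]
  obtain l where l_add: "\<And>Z Z'. Z \<in> Lp 1 M F \<Longrightarrow> Z' \<in> Lp 1 M F \<Longrightarrow> l (\<lambda>\<omega>. Z \<omega> + Z' \<omega>) = l Z + l Z'"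
    and l_scale: "\<And>Z c. Z \<in> Lp 1 M F \<Longrightarrow> l (\<lambda>\<omega>. c * Z \<omega>) = c * l Z"
    and l_le: "\<And>Z. Z \<in> Lp 1 M F \<Longrightarrow> l Z \<le> \<rho> Z"
    and l_S': "\<And>s a. (s, a) \<in> S \<times> {0} \<Longrightarrow> a \<le> l s"
    by blast
  \<comment> \<open>The constraint yields only \<open>0 \<le> l s\<close>; since \<open>S\<close>
    also contains \<open>- s\<close>, equality follows.\<close>
  have l_S: "l s = 0" if "s \<in> S" for s
  proof (rule antisym)
    show "0 \<le> l s" using l_S'[of s 0] that by simp
    have "0 \<le> l (\<lambda>\<omega>. -1 * s \<omega>)" by (rule l_S') (use S_scale[OF that, of "-1"] in simp)
    then show "l s \<le> 0" using l_scale[of s "-1"] S that by auto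
  qed
  obtain C where C: "0 \<le> C" "\<And>Z. Z \<in> Lp 1 M F \<Longrightarrow> \<rho> Z \<le> C * (\<integral>\<omega>. \<bar>Z \<omega>\<bar> \<partial>M)"
    using bounded by blast
  obtain \<zeta> where \<zeta>: "\<zeta> \<in> borel_measurable ?N" "AE \<omega> in ?N. 0 \<le> \<zeta> \<omega> \<and> \<zeta> \<omega> \<le> C"
    and l_eq: "\<And>Z. integrable ?N Z \<Longrightarrow> l Z = (\<integral>\<omega>. \<zeta> \<omega> * Z \<omega> \<partial>?N)"
  proof (rule N.positive_functional_density[of l C])
    fix Z :: "'w \<Rightarrow> real" assume Z: "integrable ?N Z"
    then have Z1: "Z \<in> Lp 1 M F" by (simp add: Lp_1_eq[OF subalg])
    show "l (\<lambda>\<omega>. c * Z \<omega>) = c * l Z" for c by (rule l_scale[OF Z1])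
    show "l (\<lambda>\<omega>. Z \<omega> + Z' \<omega>) = l Z + l Z'" if "integrable ?N Z'" for Z'
      using that by (intro l_add Z1) (simp add: Lp_1_eq[OF subalg])
    have "(\<integral>\<omega>. \<bar>Z \<omega>\<bar> \<partial>?N) = (\<integral>\<omega>. \<bar>Z \<omega>\<bar> \<partial>M)"
      using Z1 by (intro integral_subalgebra2[OF subalg]) (auto simp: Lp_def)
    with l_le[OF Z1] C(2)[OF Z1] show "l Z \<le> C * (\<integral>\<omega>. \<bar>Z \<omega>\<bar> \<partial>?N)" by simp
    \<comment> \<open>Positivity is inherited from monotonicity:
      \<open>l (- Z) \<le> \<rho> (- Z) \<le> \<rho> 0 = 0\<close>.\<close>
    show "0 \<le> l Z" if "AE \<omega> in ?N. 0 \<le> Z \<omega>"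
    proof -
      have "l (\<lambda>\<omega>. -1 * Z \<omega>) \<le> \<rho> (\<lambda>\<omega>. -1 * Z \<omega>)" by (intro l_le scale Z1)
      also have "\<dots> \<le> \<rho> (\<lambda>\<omega>. 0)"
        using AE_restr_to_subalg[OF subalg that] by (intro mono scale zero Z1) auto
      finally show ?thesis using l_scale[OF Z1, of "-1"] sublinear_zero[OF sublinear] by simp
    qed
  qed blast
  have \<zeta>F: "\<zeta> \<in> borel_measurable F" by (rule measurable_in_subalg'[OF subalg \<zeta>(1)])
  have l_eq': "l Z = (\<integral>\<omega>. \<zeta> \<omega> * Z \<omega> \<partial>M)" if "Z \<in> Lp 1 M F" for Z
  proof -
    have "(\<integral>\<omega>. \<zeta> \<omega> * Z \<omega> \<partial>?N) = (\<integral>\<omega>. \<zeta> \<omega> * Z \<omega> \<partial>M)"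
      using \<zeta>F that by (intro integral_subalgebra2[OF subalg]) (auto simp: Lp_def)
    with l_eq[of Z] that show ?thesis by (simp add: Lp_1_eq[OF subalg])
  qed
  show thesis
  proof (rule that[of \<zeta>])
    have "AE \<omega> in M. \<bar>\<zeta> \<omega>\<bar> \<le> C"
      using AE_restr_to_subalg[OF subalg \<zeta>(2)] by eventually_elim auto
    with \<zeta>F l_le l_eq' show "\<zeta> \<in> risk_subdifferential M F \<rho> (\<lambda>\<omega>. 0)"
      by (auto simp: risk_subdifferential_def Linf_def sublinear_zero[OF sublinear])
    show "(\<integral>\<omega>. \<zeta> \<omega> * s \<omega> \<partial>M) = 0" if "s \<in> S" for s
      using l_eq'[of s] l_S[OF that] S(1) that by auto
  qed
qed

end

section \<open>Controls and first-order optimality\<close>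

lemma finite_measure_time: "finite_measure (time_measure T)"
  by (intro finite_measureI) (simp add: space_restrict_space emeasure_restrict_space emeasure_lborel_Icc_eq)

lemma control_scale_space:
  assumes "h \<in> control_space T"
  shows "control_scale c h \<in> control_space T"
  using assms by (auto simp: control_space_def control_scale_def power_mult_distrib)

lemma control_add_space:
  assumes u: "u \<in> control_space T" and h: "h \<in> control_space T"
  shows "control_add u h \<in> control_space T"
proof -
  have le: "(norm (a + b))\<^sup>2 \<le> 2 * (norm a)\<^sup>2 + 2 * (norm b)\<^sup>2" for a b :: "real^'m"
  proof -
    have "(norm (a + b))\<^sup>2 \<le> (norm a + norm b)\<^sup>2" by (intro power_mono norm_triangle_ineq) simp
    also have "\<dots> \<le> 2 * (norm a)\<^sup>2 + 2 * (norm b)\<^sup>2"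
      using zero_le_power2[of "norm a - norm b"] by (simp add: power2_eq_square algebra_simps)
    finally show ?thesis .
  qed
  have "integrable (time_measure T) (\<lambda>t. (norm (fst u t + fst h t))\<^sup>2)"
    by (rule Bochner_Integration.integrable_bound[of _ "\<lambda>t. 2 * (norm (fst u t))\<^sup>2 + 2 * (norm (fst h t))\<^sup>2"])
      (use u h le in \<open>auto simp: control_space_def\<close>)
  with u h show ?thesis by (auto simp: control_space_def control_add_def)
qed

lemma control_norm_scale: "control_norm T (control_scale c h) = \<bar>c\<bar> * control_norm T h"
proof -
  have "control_inner T (control_scale c h) (control_scale c h) = c\<^sup>2 * control_inner T h h"
    by (simp add: control_inner_def control_scale_def power2_eq_square distrib_left mult.assoc)
  then show ?thesis by (simp add: control_norm_def real_sqrt_mult)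
qed

lemma control_norm_nonneg: "0 \<le> control_norm T h"
  by (simp add: control_norm_def control_inner_def)

section \<open>Pairing a random gradient with a fixed control\<close>

lemma control_inner_measurable:
  fixes G :: "'w \<Rightarrow> ('m::finite, 'q::finite) control"
  assumes G: "G \<in> L2_control M F T" and h: "h \<in> control_space T"
  shows "(\<lambda>\<omega>. control_inner T (G \<omega>) h) \<in> borel_measurable F"
proof -
  interpret finite_measure "time_measure T" by (rule finite_measure_time)
  have [measurable]: "(\<lambda>(\<omega>, t). fst (G \<omega>) t) \<in> borel_measurable (F \<Otimes>\<^sub>M time_measure T)"
    "(\<lambda>\<omega>. snd (G \<omega>)) \<in> borel_measurable F" "fst h \<in> borel_measurable (time_measure T)"
    using G h by (auto simp: L2_control_def control_space_def)
  show ?thesis unfolding control_inner_def by measurable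
qed

text \<open>Fubini's theorem: the time integral in the inner product and the expectation are
  exchanged. Integrability on the product space comes from the essential bound on \<zeta> and the
  square integrability of \<open>G\<close> and \<open>h\<close>.\<close>

lemma control_inner_expectation:
  fixes G :: "'w \<Rightarrow> ('m::finite, 'q::finite) control"
  assumes "prob_space M" and sub: "subalgebra M F"
    and \<zeta>: "\<zeta> \<in> Linf M F" and G: "G \<in> L2_control M F T" and h: "h \<in> control_space T"
  shows "control_inner T (control_expectation M (\<lambda>\<omega>. control_scale (\<zeta> \<omega>) (G \<omega>))) h =
         (\<integral>\<omega>. \<zeta> \<omega> * control_inner T (G \<omega>) h \<partial>M)"
proof -
  \<comment> \<open>\<open>G\<close> is jointly measurable only with respect to \<open>F\<close> and
    time, so the product space is built on the restriction of \<open>M\<close> to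
    \<open>F\<close>.\<close>
  define N where "N = restr_to_subalg M F"
  define \<tau> where "\<tau> = time_measure T"
  interpret N: prob_space N unfolding N_def by (rule prob_space_restr_to_subalg[OF sub assms(1)])
  interpret \<tau>: finite_measure \<tau> unfolding \<tau>_def by (rule finite_measure_time)
  interpret P: pair_sigma_finite N \<tau> ..
  have NF [measurable_cong]: "sets N = sets F" unfolding N_def by (rule sets_restr_to_subalg[OF sub])
  define g where "g p = fst (G (fst p)) (snd p)" for p
  define r where "r \<omega> = snd (G \<omega>)" for \<omega>
  define v where "v = fst h"
  have "g \<in> borel_measurable (F \<Otimes>\<^sub>M \<tau>)"
    using G by (simp add: L2_control_def g_def[abs_def] \<tau>_def split_beta')
  then have [measurable]: "g \<in> borel_measurable (N \<Otimes>\<^sub>M \<tau>)"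
    by (subst measurable_cong_sets[OF sets_pair_measure_cong[OF NF refl] refl])
  have [measurable]: "r \<in> borel_measurable N" "\<zeta> \<in> borel_measurable N"
    using G \<zeta> measurable_in_subalg[OF sub]
    by (auto simp: L2_control_def Linf_def r_def[abs_def] N_def)
  have [measurable]: "v \<in> borel_measurable \<tau>" and v2: "integrable \<tau> (\<lambda>t. (norm (v t))\<^sup>2)"
    using h by (auto simp: control_space_def v_def \<tau>_def)
  obtain C where "AE \<omega> in M. \<bar>\<zeta> \<omega>\<bar> \<le> C" using \<zeta> by (auto simp: Linf_def)
  then have C: "AE \<omega> in N. \<bar>\<zeta> \<omega>\<bar> \<le> C"
    unfolding N_def using \<zeta> by (intro AE_restr_to_subalg2[OF sub]) (auto simp: Linf_def)
  have L2: "(\<integral>\<^sup>+\<omega>. (\<integral>\<^sup>+t. ennreal ((norm (g (\<omega>, t)))\<^sup>2) \<partial>\<tau>) + ennreal ((norm (r \<omega>))\<^sup>2) \<partial>N) < \<infinity>"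
  proof -
    let ?k = "\<lambda>\<omega>. (\<integral>\<^sup>+t. ennreal ((norm (g (\<omega>, t)))\<^sup>2) \<partial>\<tau>) + ennreal ((norm (r \<omega>))\<^sup>2)"
    have "?k \<in> borel_measurable N" by measurable
    then have "?k \<in> borel_measurable F" unfolding N_def by (rule measurable_in_subalg'[OF sub])
    then have "(\<integral>\<^sup>+\<omega>. ?k \<omega> \<partial>N) = (\<integral>\<^sup>+\<omega>. ?k \<omega> \<partial>M)"
      unfolding N_def by (rule nn_integral_subalgebra2[OF sub])
    then show ?thesis using G by (simp add: L2_control_def g_def r_def \<tau>_def)
  qed
  have g2: "integrable (N \<Otimes>\<^sub>M \<tau>) (\<lambda>p. (norm (g p))\<^sup>2)"
  proof (rule integrableI_nonneg)
    have "(\<integral>\<^sup>+p. ennreal ((norm (g p))\<^sup>2) \<partial>(N \<Otimes>\<^sub>M \<tau>)) = (\<integral>\<^sup>+\<omega>. (\<integral>\<^sup>+t. ennreal ((norm (g (\<omega>, t)))\<^sup>2) \<partial>\<tau>) \<partial>N)"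
      by (rule \<tau>.nn_integral_fst[symmetric]) measurable
    also have "\<dots> \<le> (\<integral>\<^sup>+\<omega>. (\<integral>\<^sup>+t. ennreal ((norm (g (\<omega>, t)))\<^sup>2) \<partial>\<tau>) + ennreal ((norm (r \<omega>))\<^sup>2) \<partial>N)"
      by (intro nn_integral_mono) simp
    finally show "(\<integral>\<^sup>+p. ennreal ((norm (g p))\<^sup>2) \<partial>(N \<Otimes>\<^sub>M \<tau>)) < \<infinity>" using L2 by (rule le_less_trans)
  qed auto
  have r2: "integrable N (\<lambda>\<omega>. (norm (r \<omega>))\<^sup>2)"
  proof (rule integrableI_nonneg)
    have "(\<integral>\<^sup>+\<omega>. ennreal ((norm (r \<omega>))\<^sup>2) \<partial>N) \<le> (\<integral>\<^sup>+\<omega>. (\<integral>\<^sup>+t. ennreal ((norm (g (\<omega>, t)))\<^sup>2) \<partial>\<tau>) + ennreal ((norm (r \<omega>))\<^sup>2) \<partial>N)"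
      by (intro nn_integral_mono) simp
    then show "(\<integral>\<^sup>+\<omega>. ennreal ((norm (r \<omega>))\<^sup>2) \<partial>N) < \<infinity>" using L2 by (rule le_less_trans)
  qed auto
  \<comment> \<open>On finite measures these two elementary bounds reduce integrability of norms and
    inner products to that of squares.\<close>
  have le1: "norm x \<le> 1 + (norm x)\<^sup>2" for x :: "'b::real_normed_vector"
  proof -
    have "0 \<le> (norm x - 1)\<^sup>2 + norm x" by simp
    then show ?thesis by (simp add: power2_eq_square algebra_simps)
  qed
  have le2: "\<bar>x \<bullet> y\<bar> \<le> (norm x)\<^sup>2 + (norm y)\<^sup>2" for x y :: "'b::real_inner"
  proof -
    have "0 \<le> (norm x - norm y)\<^sup>2 + ((norm x)\<^sup>2 + (norm y)\<^sup>2)" by simp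
    then have "norm x * norm y \<le> (norm x)\<^sup>2 + (norm y)\<^sup>2"
      by (simp add: power2_eq_square algebra_simps)
    with Cauchy_Schwarz_ineq2[of x y] show ?thesis by simp
  qed
  have \<zeta>r: "integrable N (\<lambda>\<omega>. \<zeta> \<omega> *\<^sub>R r \<omega>)"
  proof (rule Bochner_Integration.integrable_bound)
    show "integrable N (\<lambda>\<omega>. C * (1 + (norm (r \<omega>))\<^sup>2))" using r2 by simp
    show "AE \<omega> in N. norm (\<zeta> \<omega> *\<^sub>R r \<omega>) \<le> norm (C * (1 + (norm (r \<omega>))\<^sup>2))"
      using C by eventually_elim (use le1 in \<open>auto simp: abs_mult intro!: mult_mono\<close>)
  qed measurable
  have C_pair: "AE p in N \<Otimes>\<^sub>M \<tau>. \<bar>\<zeta> (fst p)\<bar> \<le> C"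
    using C by (intro P.AE_pair_measure) auto
  \<comment> \<open>Used twice: for \<open>g\<close> itself, so that its expectation exists at
    almost every time, and for \<open>g \<bullet> v\<close>, so that Fubini's theorem
    applies.\<close>
  have \<zeta>_mult: "integrable (N \<Otimes>\<^sub>M \<tau>) (\<lambda>p. \<zeta> (fst p) *\<^sub>R k p)"
    if [measurable]: "k \<in> borel_measurable (N \<Otimes>\<^sub>M \<tau>)" and b: "integrable (N \<Otimes>\<^sub>M \<tau>) b"
      and kb: "\<And>p. norm (k p) \<le> b p"
    for k :: "_ \<Rightarrow> 'b::{banach, second_countable_topology}" and b
  proof (rule Bochner_Integration.integrable_bound)
    show "integrable (N \<Otimes>\<^sub>M \<tau>) (\<lambda>p. C * b p)" using b by simp
    show "AE p in N \<Otimes>\<^sub>M \<tau>. norm (\<zeta> (fst p) *\<^sub>R k p) \<le> norm (C * b p)"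
      using C_pair
    proof eventually_elim
      case (elim p)
      have "norm (k p) \<le> \<bar>b p\<bar>" using kb[of p] by simp
      with elim show ?case by (auto simp: abs_mult intro!: mult_mono)
    qed
  qed measurable
  have P_fin: "integrable (N \<Otimes>\<^sub>M \<tau>) (\<lambda>p. c p)" if "integrable \<tau> d" "\<And>p. c p = d (snd p)" for c and d :: "real \<Rightarrow> real"
  proof (rule P.Fubini_integrable)
    show "c \<in> borel_measurable (N \<Otimes>\<^sub>M \<tau>)" using that by (auto simp: that(2)[abs_def])
  qed (use that in auto)
  have \<zeta>g: "integrable (N \<Otimes>\<^sub>M \<tau>) (\<lambda>p. \<zeta> (fst p) *\<^sub>R g p)"
    by (rule \<zeta>_mult[of g "\<lambda>p. 1 + (norm (g p))\<^sup>2"]) (use g2 P_fin[of "\<lambda>_. 1"] le1 in auto)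
  have \<zeta>gv: "integrable (N \<Otimes>\<^sub>M \<tau>) (\<lambda>p. \<zeta> (fst p) *\<^sub>R (g p \<bullet> v (snd p)))"
    by (rule \<zeta>_mult[of _ "\<lambda>p. (norm (g p))\<^sup>2 + (norm (v (snd p)))\<^sup>2"]) (use g2 P_fin[OF v2] le2 in auto)
  have inner_eq: "control_inner T (G \<omega>) h = (\<integral>t. g (\<omega>, t) \<bullet> v t \<partial>\<tau>) + r \<omega> \<bullet> snd h" for \<omega>
    by (simp add: control_inner_def g_def r_def v_def \<tau>_def)
  have "(\<integral>\<omega>. \<zeta> \<omega> * control_inner T (G \<omega>) h \<partial>M) = (\<integral>\<omega>. \<zeta> \<omega> * control_inner T (G \<omega>) h \<partial>N)"
    using \<zeta> control_inner_measurable[OF G h] unfolding N_def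
    by (intro integral_subalgebra2[OF sub, symmetric]) (simp add: Linf_def)
  also have "\<dots> = (\<integral>\<omega>. (\<integral>t. \<zeta> \<omega> *\<^sub>R (g (\<omega>, t) \<bullet> v t) \<partial>\<tau>) + (\<zeta> \<omega> *\<^sub>R r \<omega>) \<bullet> snd h \<partial>N)"
    by (simp add: inner_eq distrib_left)
  also have "\<dots> = (\<integral>\<omega>. (\<integral>t. \<zeta> \<omega> *\<^sub>R (g (\<omega>, t) \<bullet> v t) \<partial>\<tau>) \<partial>N) + (\<integral>\<omega>. \<zeta> \<omega> *\<^sub>R r \<omega> \<partial>N) \<bullet> snd h"
    using P.integrable_fst'[OF \<zeta>gv] \<zeta>r
    by (subst Bochner_Integration.integral_add) (auto simp del: inner_scaleR_left)
  also have "(\<integral>\<omega>. (\<integral>t. \<zeta> \<omega> *\<^sub>R (g (\<omega>, t) \<bullet> v t) \<partial>\<tau>) \<partial>N) = (\<integral>t. (\<integral>\<omega>. \<zeta> \<omega> *\<^sub>R (g (\<omega>, t) \<bullet> v t) \<partial>N) \<partial>\<tau>)"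
    by (rule P.Fubini_integral[symmetric]) (use \<zeta>gv in \<open>simp add: split_beta'\<close>)
  also have "\<dots> = (\<integral>t. (\<integral>\<omega>. \<zeta> \<omega> *\<^sub>R g (\<omega>, t) \<partial>N) \<bullet> v t \<partial>\<tau>)"
  proof (rule integral_cong_AE)
    \<comment> \<open>Pulling \<open>v t\<close> out of the expectation relies on an integrable
      section. This holds for almost every \<open>t\<close>, which is enough under the time
      integral.\<close>
    have "AE t in \<tau>. integrable N (\<lambda>\<omega>. \<zeta> \<omega> *\<^sub>R g (\<omega>, t))"
      by (rule P.AE_integrable_snd) (use \<zeta>g in \<open>simp add: split_beta'\<close>)
    then show "AE t in \<tau>. (\<integral>\<omega>. \<zeta> \<omega> *\<^sub>R (g (\<omega>, t) \<bullet> v t) \<partial>N) = (\<integral>\<omega>. \<zeta> \<omega> *\<^sub>R g (\<omega>, t) \<partial>N) \<bullet> v t"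
      by eventually_elim (simp flip: integral_inner_left)
  qed measurable
  also have "\<dots> = (\<integral>t. (\<integral>\<omega>. \<zeta> \<omega> *\<^sub>R g (\<omega>, t) \<partial>M) \<bullet> v t \<partial>\<tau>)"
  proof (intro Bochner_Integration.integral_cong refl)
    fix t assume "t \<in> space \<tau>"
    then have "(\<lambda>\<omega>. \<zeta> \<omega> *\<^sub>R g (\<omega>, t)) \<in> borel_measurable N" by measurable
    then have "(\<lambda>\<omega>. \<zeta> \<omega> *\<^sub>R g (\<omega>, t)) \<in> borel_measurable F"
      unfolding N_def by (rule measurable_in_subalg'[OF sub])
    then show "(\<integral>\<omega>. \<zeta> \<omega> *\<^sub>R g (\<omega>, t) \<partial>N) \<bullet> v t = (\<integral>\<omega>. \<zeta> \<omega> *\<^sub>R g (\<omega>, t) \<partial>M) \<bullet> v t"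
      unfolding N_def by (simp only: integral_subalgebra2[OF sub])
  qed
  also have "(\<integral>\<omega>. \<zeta> \<omega> *\<^sub>R r \<omega> \<partial>N) = (\<integral>\<omega>. \<zeta> \<omega> *\<^sub>R r \<omega> \<partial>M)"
    unfolding N_def
  proof (rule integral_subalgebra2[OF sub])
    have "(\<lambda>\<omega>. \<zeta> \<omega> *\<^sub>R r \<omega>) \<in> borel_measurable N" by measurable
    then show "(\<lambda>\<omega>. \<zeta> \<omega> *\<^sub>R r \<omega>) \<in> borel_measurable F"
      unfolding N_def by (rule measurable_in_subalg'[OF sub])
  qed
  finally show ?thesis
    by (simp add: control_inner_def control_expectation_def control_scale_def g_def r_def v_def \<tau>_def)
qed

section \<open>First-order optimality under the risk measure\<close>

context coherent_risk
begin

text \<open>Bridges the exponents: differentiability of \<open>J\<close> is measured in L^2, whereas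
  \<open>bounded\<close> controls \<open>\<rho>\<close> by the L^1 norm.\<close>

lemma Lp_2_L1:
  assumes "Z \<in> Lp 2 M F"
  shows "Z \<in> Lp 1 M F" "(\<integral>\<omega>. \<bar>Z \<omega>\<bar> \<partial>M) \<le> L2_norm M Z"
proof -
  interpret prob_space M by (rule prob)
  have "Z \<in> borel_measurable M" "integrable M (\<lambda>\<omega>. (Z \<omega>)\<^sup>2)" "Z \<in> borel_measurable F"
    using assms measurable_from_subalg[OF subalg] by (auto simp: Lp_def)
  with square_integrable_L1[of Z] show "Z \<in> Lp 1 M F" "(\<integral>\<omega>. \<bar>Z \<omega>\<bar> \<partial>M) \<le> L2_norm M Z"
    by (auto simp: Lp_def L2_norm_def)
qed

lemma Lp_2_diff:
  assumes "Z \<in> Lp 2 M F" "Z' \<in> Lp 2 M F"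
  shows "(\<lambda>\<omega>. Z \<omega> - Z' \<omega>) \<in> Lp 2 M F"
proof -
  have [measurable]: "Z \<in> borel_measurable F" "Z' \<in> borel_measurable F"
    and int: "integrable M (\<lambda>\<omega>. (Z \<omega>)\<^sup>2)" "integrable M (\<lambda>\<omega>. (Z' \<omega>)\<^sup>2)"
    using assms by (auto simp: Lp_def)
  have le: "(a - b)\<^sup>2 \<le> 2 * a\<^sup>2 + 2 * b\<^sup>2" for a b :: real
    using zero_le_power2[of "a + b"] by (simp add: power2_eq_square algebra_simps)
  have "integrable M (\<lambda>\<omega>. (Z \<omega> - Z' \<omega>)\<^sup>2)"
    by (rule Bochner_Integration.integrable_bound[of _ "\<lambda>\<omega>. 2 * (Z \<omega>)\<^sup>2 + 2 * (Z' \<omega>)\<^sup>2"])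
      (use int le in \<open>auto intro!: measurable_from_subalg[OF subalg]\<close>)
  then show ?thesis by (simp add: Lp_def)
qed

text \<open>Subadditivity takes the place of a chain rule for \<open>\<rho>\<close>. It splits
  \<open>J w\<close> into \<open>J u\<close>, a remainder and \<open>D k\<close>; optimality cancels
  the first term, and the remainder is negligible compared with the step length.\<close>

lemma optimal_derivative_nonneg:
  fixes J :: "('m::finite, 'q::finite) control \<Rightarrow> 'w \<Rightarrow> real"
  assumes J: "\<And>u. u \<in> control_space T \<Longrightarrow> J u \<in> Lp 2 M F"
    and D: "has_frechet_derivative_L2 M F T J u D"
    and u: "u \<in> control_space T" and opt: "\<And>w. w \<in> control_space T \<Longrightarrow> \<rho> (J u) \<le> \<rho> (J w)"
    and h: "h \<in> control_space T"
  shows "0 \<le> \<rho> (D h)"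
proof -
  obtain C where C: "0 \<le> C" "\<And>Z. Z \<in> Lp 1 M F \<Longrightarrow> \<rho> Z \<le> C * (\<integral>\<omega>. \<bar>Z \<omega>\<bar> \<partial>M)"
    using bounded by blast
  define n where "n = control_norm T h"
  have n: "0 \<le> n" by (simp add: n_def control_norm_nonneg)
  have DL2: "D k \<in> Lp 2 M F" if "k \<in> control_space T" for k
    using D that by (simp add: has_frechet_derivative_L2_def)
  have step: "0 \<le> C * (\<epsilon> * n) + \<rho> (D h)" if "0 < \<epsilon>" for \<epsilon>
  proof -
    from D \<open>0 < \<epsilon>\<close> obtain \<delta> where \<delta>: "0 < \<delta>"
      "\<And>k. k \<in> control_space T \<Longrightarrow> control_norm T k < \<delta> \<Longrightarrow>
        L2_norm M (\<lambda>\<omega>. J (control_add u k) \<omega> - J u \<omega> - D k \<omega>) \<le> \<epsilon> * control_norm T k"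
      unfolding has_frechet_derivative_L2_def by meson
    \<comment> \<open>The summand 1 guarantees \<open>t * n < \<delta>\<close> and keeps the
      quotient meaningful when \<open>n\<close> is 0.\<close>
    define t where "t = \<delta> / (n + 1)"
    have t: "0 < t" using \<delta>(1) n by (simp add: t_def)
    define k where "k = control_scale t h"
    define w where "w = control_add u k"
    have k: "k \<in> control_space T" unfolding k_def by (rule control_scale_space[OF h])
    have w: "w \<in> control_space T" unfolding w_def by (rule control_add_space[OF u k])
    have norm_k: "control_norm T k = t * n"
      using t by (simp add: k_def n_def control_norm_scale)
    have "t * n < \<delta>" using \<delta>(1) n by (simp add: t_def field_simps)
    \<comment> \<open>The linearisation error is kept as a separate summand: \<open>bounded\<close>
      is applied to it alone, while \<open>\<rho> (D k)\<close> is computed exactly by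
      homogeneity.\<close>
    define R where "R \<omega> = J w \<omega> - J u \<omega> - D k \<omega>" for \<omega>
    have R2: "R \<in> Lp 2 M F" unfolding R_def[abs_def] by (intro Lp_2_diff J w u DL2 k)
    have R: "R \<in> Lp 1 M F" by (rule Lp_2_L1[OF R2])
    have Dk: "D k \<in> Lp 1 M F" by (rule Lp_2_L1[OF DL2[OF k]])
    have Dh: "D h \<in> Lp 1 M F" by (rule Lp_2_L1[OF DL2[OF h]])
    have Ju: "J u \<in> Lp 1 M F" by (rule Lp_2_L1[OF J[OF u]])
    have "L2_norm M R \<le> \<epsilon> * (t * n)"
      using \<delta>(2)[OF k] norm_k \<open>t * n < \<delta>\<close> by (simp add: R_def[abs_def] w_def)
    then have "(\<integral>\<omega>. \<bar>R \<omega>\<bar> \<partial>M) \<le> \<epsilon> * (t * n)" using Lp_2_L1(2)[OF R2] by simp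
    then have \<rho>R: "\<rho> R \<le> C * (\<epsilon> * (t * n))"
      using C(2)[OF R] mult_left_mono[OF _ C(1)] by (meson order_trans)
    have "AE \<omega> in M. D k \<omega> = t * D h \<omega>"
      using D h by (simp add: has_frechet_derivative_L2_def k_def)
    then have \<rho>D: "\<rho> (D k) = t * \<rho> (D h)"
      using cong[OF Dk scale[OF Dh]] sublinear_scale[OF sublinear Dh, of t] t by simp
    have "\<rho> (J u) \<le> \<rho> (J w)" by (rule opt[OF w])
    also have "J w = (\<lambda>\<omega>. J u \<omega> + (R \<omega> + D k \<omega>))" by (simp add: R_def fun_eq_iff)
    also have "\<rho> \<dots> \<le> \<rho> (J u) + \<rho> (\<lambda>\<omega>. R \<omega> + D k \<omega>)"
      by (intro sublinear_add sublinear add Ju R Dk)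
    also have "\<rho> (\<lambda>\<omega>. R \<omega> + D k \<omega>) \<le> \<rho> R + \<rho> (D k)"
      by (intro sublinear_add sublinear R Dk)
    finally have "0 \<le> C * (\<epsilon> * (t * n)) + t * \<rho> (D h)" using \<rho>R \<rho>D by simp
    also have "\<dots> = t * (C * (\<epsilon> * n) + \<rho> (D h))" by (simp add: algebra_simps)
    finally show ?thesis using t by (simp add: zero_le_mult_iff)
  qed
  show ?thesis
  proof (rule field_le_epsilon)
    fix e :: real assume e: "0 < e"
    \<comment> \<open>Chosen so that \<open>C * (\<epsilon> * n) \<le> e\<close>; the summand 1
      covers the case where \<open>C * n\<close> vanishes.\<close>
    define \<epsilon> where "\<epsilon> = e / (C * n + 1)"
    have "0 < \<epsilon>" using e C(1) n by (simp add: \<epsilon>_def add_nonneg_pos)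
    moreover have "C * (\<epsilon> * n) \<le> e"
    proof -
      have "0 < C * n + 1" using C(1) n by (simp add: add_nonneg_pos)
      then have "\<epsilon> * (C * n + 1) = e" by (simp add: \<epsilon>_def)
      with \<open>0 < \<epsilon>\<close> show ?thesis by (simp add: algebra_simps)
    qed
    ultimately show "0 \<le> \<rho> (D h) + e" using step[of \<epsilon>] by simp
  qed
qed

end

section \<open>Annihilating the range of the derivative at the optimum\<close>

theorem proposition3p2:
  fixes M :: "'w measure" and T L :: real and W :: "real \<Rightarrow> 'w \<Rightarrow> real"
    and b :: "real \<Rightarrow> real^'n \<Rightarrow> real^'m \<Rightarrow> real^'n"
    and \<sigma> :: "real \<Rightarrow> real^'n \<Rightarrow> real^'n"
    and X0 :: "real^'n"
    and K :: "real^'q \<Rightarrow> real^'n \<Rightarrow> real^'m"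
    and f :: "real \<Rightarrow> real^'n \<Rightarrow> real^'m \<Rightarrow> real"
    and g :: "real \<Rightarrow> real^'n \<Rightarrow> real"
    and X :: "('m, 'q) control \<Rightarrow> real \<Rightarrow> 'w \<Rightarrow> real^'n"
    and J :: "('m, 'q) control \<Rightarrow> 'w \<Rightarrow> real"
    and gradJ :: "('m, 'q) control \<Rightarrow> 'w \<Rightarrow> ('m, 'q) control"
    and \<rho> :: "('w \<Rightarrow> real) \<Rightarrow> real"
    and u_opt :: "('m, 'q) control"
  defines "F \<equiv> wiener_filtration M W"
  assumes "prob_space M" and "T > 0" and "wiener_process M T W"
    and "L > 0" and "admissible_drift T b L" and "admissible_diffusion T \<sigma> L"
    and "admissible_feedback K" and "admissible_cost T f g"
    and state: "\<And>u. u \<in> control_space T \<Longrightarrow> unique_closed_loop_solution M W T b \<sigma> X0 K u (X u)"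
    and cost: "cost_functional M (F T) T f g K X J"
    and gradient: "\<And>u. u \<in> control_space T \<Longrightarrow> riesz_gradient M (F T) T J u (gradJ u)"
    and risk: "coherent_risk_measure M (F T) \<rho>"
    and optimal: "u_opt \<in> control_space T" "\<And>u. u \<in> control_space T \<Longrightarrow> \<rho> (J u_opt) \<le> \<rho> (J u)"
  shows "\<exists>\<zeta> \<in> risk_subdifferential M (F T) \<rho> (\<lambda>\<omega>. 0). \<forall>h \<in> control_space T.
           control_inner T
             (control_expectation M (\<lambda>\<omega>. control_scale (\<zeta> \<omega>) (gradJ u_opt \<omega>))) h = 0"
proof -
  have subalg: "subalgebra M (F T)"
    unfolding F_def using \<open>wiener_process M T W\<close>
    by (intro subalgebra_wiener_filtration) (simp add: wiener_process_def)
  interpret coherent_risk M "F T" \<rho>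
    by (rule coherent_risk.intro[OF \<open>prob_space M\<close> subalg risk])
  have J: "J u \<in> Lp 2 M (F T)" if "u \<in> control_space T" for u
    using cost that by (simp add: cost_functional_def)
  obtain D where G: "gradJ u_opt \<in> L2_control M (F T) T"
    and D: "has_frechet_derivative_L2 M (F T) T J u_opt D"
    and DG: "\<And>h. h \<in> control_space T \<Longrightarrow> AE \<omega> in M. D h \<omega> = control_inner T (gradJ u_opt \<omega>) h"
    using gradient[OF optimal(1)] by (auto simp: riesz_gradient_def)
  have D1: "D h \<in> Lp 1 M (F T)" if "h \<in> control_space T" for h
    using D that by (intro Lp_2_L1) (simp add: has_frechet_derivative_L2_def)
  \<comment> \<open>\<open>D\<close> is linear only up to null sets, so its range is closed under almost sure equality.\<close>
  define S where "S = {Z \<in> Lp 1 M (F T). \<exists>h\<in>control_space T. AE \<omega> in M. Z \<omega> = D h \<omega>}"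
  have S_scale: "(\<lambda>\<omega>. c * s \<omega>) \<in> S" if s: "s \<in> S" for s c
  proof -
    obtain h where h: "h \<in> control_space T" "AE \<omega> in M. s \<omega> = D h \<omega>" using s by (auto simp: S_def)
    have "AE \<omega> in M. D (control_scale c h) \<omega> = c * D h \<omega>"
      using D h(1) by (simp add: has_frechet_derivative_L2_def)
    with h(2) have "AE \<omega> in M. c * s \<omega> = D (control_scale c h) \<omega>" by eventually_elim simp
    with s control_scale_space[OF h(1)] show ?thesis by (auto simp: S_def intro: scale)
  qed
  have S_add: "(\<lambda>\<omega>. s \<omega> + t \<omega>) \<in> S" if s: "s \<in> S" and t: "t \<in> S" for s t
  proof -
    obtain h k where h: "h \<in> control_space T" "AE \<omega> in M. s \<omega> = D h \<omega>"
      and k: "k \<in> control_space T" "AE \<omega> in M. t \<omega> = D k \<omega>" using s t by (auto simp: S_def)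
    have "AE \<omega> in M. D (control_add h k) \<omega> = D h \<omega> + D k \<omega>"
      using D h(1) k(1) by (simp add: has_frechet_derivative_L2_def)
    with h(2) k(2) have "AE \<omega> in M. s \<omega> + t \<omega> = D (control_add h k) \<omega>" by eventually_elim simp
    with s t control_add_space[OF h(1) k(1)] show ?thesis by (auto simp: S_def intro: add)
  qed
  have DS: "D h \<in> S" if "h \<in> control_space T" for h
    using D1[OF that] that by (auto simp: S_def)
  \<comment> \<open>The optimal control serves here only as some available direction, whose
    derivative is scaled by \<open>0\<close>.\<close>
  have S_zero: "(\<lambda>\<omega>. 0) \<in> S" using S_scale[OF DS[OF optimal(1)], of 0] by simp
  have S_nonneg: "0 \<le> \<rho> s" if s: "s \<in> S" for s
  proof -
    obtain h where h: "h \<in> control_space T" "AE \<omega> in M. s \<omega> = D h \<omega>" using s by (auto simp: S_def)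
    have "\<rho> s = \<rho> (D h)" using s by (intro cong D1 h) (simp add: S_def)
    with optimal_derivative_nonneg[OF J D optimal h(1)] show ?thesis by simp
  qed
  obtain \<zeta> where \<zeta>: "\<zeta> \<in> risk_subdifferential M (F T) \<rho> (\<lambda>\<omega>. 0)"
    and \<zeta>S: "\<And>s. s \<in> S \<Longrightarrow> (\<integral>\<omega>. \<zeta> \<omega> * s \<omega> \<partial>M) = 0"
    by (rule subgradient_annihilating[OF _ S_zero S_add S_scale S_nonneg]) (auto simp: S_def)
  show ?thesis
  proof (intro bexI[OF _ \<zeta>] ballI)
    fix h :: "('m, 'q) control" assume h: "h \<in> control_space T"
    have \<zeta>inf: "\<zeta> \<in> Linf M (F T)" using \<zeta> by (simp add: risk_subdifferential_def)
    \<comment> \<open>The pairing moves inside the expectation, where it equals \<open>D h\<close>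
      almost surely; \<open>D h\<close> lies in \<open>S\<close>, which \<zeta> annihilates.\<close>
    have "control_inner T (control_expectation M (\<lambda>\<omega>. control_scale (\<zeta> \<omega>) (gradJ u_opt \<omega>))) h =
        (\<integral>\<omega>. \<zeta> \<omega> * control_inner T (gradJ u_opt \<omega>) h \<partial>M)"
      by (rule control_inner_expectation[OF \<open>prob_space M\<close> subalg \<zeta>inf G h])
    also have "\<dots> = (\<integral>\<omega>. \<zeta> \<omega> * D h \<omega> \<partial>M)"
    proof (rule integral_cong_AE)
      show "AE \<omega> in M. \<zeta> \<omega> * control_inner T (gradJ u_opt \<omega>) h = \<zeta> \<omega> * D h \<omega>"
        using DG[OF h] by eventually_elim simp
      show "(\<lambda>\<omega>. \<zeta> \<omega> * control_inner T (gradJ u_opt \<omega>) h) \<in> borel_measurable M"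
        "(\<lambda>\<omega>. \<zeta> \<omega> * D h \<omega>) \<in> borel_measurable M"
        using \<zeta>inf D1[OF h] control_inner_measurable[OF G h]
        by (auto intro!: measurable_from_subalg[OF subalg] simp: Linf_def Lp_def)
    qed
    also have "\<dots> = 0" by (rule \<zeta>S[OF DS[OF h]])
    finally show "control_inner T (control_expectation M (\<lambda>\<omega>. control_scale (\<zeta> \<omega>) (gradJ u_opt \<omega>))) h = 0" .
  qed
qed

end
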